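(* Let $\mu>0$, $\gamma>0$, and assume that the pressure law is given by $p_\varepsilon(v)=\varepsilon (v-1)^{-\gamma}$ for $v>1$. 1. Let $1<v_-<v_+$, and let $u_+,u_-$ be such that $(u_+-u_-)^2=-(v_+-v_-)(p_\varepsilon(v_+)-p_\varepsilon(v_-))$. Then there exists a unique (up to a shift) traveling front solution $(u,v)(t,x)=(\mathfrak u_\varepsilon,\mathfrak v_\varepsilon)(x-s_\varepsilon t)$ of $$\partial_t v-\partial_x u=0,\qquad \partial_t u+\partial_x p_\varepsilon(v)-\mu\,\partial_x\Big(\frac1v\partial_x u\Big)=0,\qquad (v,u)(t,x)\to(v_\pm,u_\pm)\ \text{ as } x\to\pm\infty .$$ The shock speed $s_\varepsilon$ satisfies the Rankine–Hugoniot condition $s_\varepsilon^2=-\dfrac{p_\varepsilon(v_+)-p_\varepsilon(v_-)}{v_+-v_-}$. 2. Take $v_-=1+\varepsilon^{1/\gamma}$ and $v_+>1$ (independent of $\varepsilon$). Let $r:=\dfrac{v_+}{\mu\sqrt{v_+-1}}$ and define the partially congested profile $(\bar{\mathfrak u},\bar{\mathfrak v})$ such that $$\bar{\mathfrak v}(\xi):=\begin{cases}1 & \text{if }\xi<0,\\ \dfrac{v_+}{1+(v_+-1)e^{-r\xi}} & \text{if }\xi\ge 0,\end{cases}\qquad \bar{\mathfrak u}'=-\frac{u_--u_+}{v_+-1}\,\bar{\mathfrak v}',$$ which is solution to the limit (free-congested) system $$\partial_t v-\partial_x u=0,\qquad \partial_t u+\partial_x p-\mu\,\partial_x\Big(\frac1v\partial_xu\Big)=0,\qquad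 v\ge 1,\ (v-1)p=0,\ p\ge 0.$$ Then $$\lim_{\varepsilon\to0}\ \sup_{\xi\in\mathbb R}\ \inf_{C\in\mathbb R}\big|\mathfrak v_\varepsilon(\xi+C)-\bar{\mathfrak v}(\xi)\big|=0 .$$ 3. Assume additionally (in the setting of part 2) that $\gamma\ge1$, and fix the shift in $\mathfrak v_\varepsilon$ by choosing $\mathfrak v_\varepsilon(0)$ such that $\mathfrak v_\varepsilon(0)-1\propto\varepsilon^{\frac1{\gamma+1}}$. There exist constants $\bar C,\underline C,\bar\sigma,\underline\sigma$, independent of $\varepsilon$, and a number $\xi_\varepsilon$ with $\lim_{\varepsilon\to0}\xi_\varepsilon=0$, such that for all $\xi<\xi_\varepsilon$, $$\underline C\,\varepsilon^{1/\gamma}\exp(\underline\sigma\,\varepsilon^{-1/\gamma}\xi)\ \le\ \mathfrak v_\varepsilon(\xi)-v_-\ \le\ \bar C\,\varepsilon^{1/\gamma}\exp(\bar\sigma\,\varepsilon^{-1/\gamma}\xi).$$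
   Context: The parameter $\varepsilon>0$ is small ($\varepsilon\ll1$); in parts 2 and 3 this includes $v_-=1+\varepsilon^{1/\gamma}<v_+$. "Up to a shift" means up to a translation in the variable $\xi=x-s_\varepsilon t$; in part 2 the infimum over $C$ accounts for the fact that $\mathfrak v_\varepsilon$ is only defined up to a shift, and $\mathfrak v_\varepsilon$ is the specific volume profile given by part 1. The notation $\mathfrak v_\varepsilon(0)-1\propto\varepsilon^{1/(\gamma+1)}$ means that $\mathfrak v_\varepsilon(0)-1$ is proportional to $\varepsilon^{1/(\gamma+1)}$ with a positive factor independent of $\varepsilon$. That $(\bar{\mathfrak u},\bar{\mathfrak v})$ is solution to the limit system is meant as follows: $(u,v,p)(t,x)=(\bar{\mathfrak u},\bar{\mathfrak v},\bar{\mathfrak p})(x-\bar st)$ solves it, with $u_\pm$ the end states of $\bar{\mathfrak u}$ at $\pm\infty$, speed $\bar s=\frac{u_--u_+}{v_+-1}=(v_+-1)^{-1/2}$ (the limit of $s_\varepsilon$), and pressure $\bar{\mathfrak p}$ equal to the constant $\frac{(u_--u_+)^2}{v_+-1}$ for $\xi<0$ and to $0$ for $\xi>0$.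
   Formalization: The hypothesis u_+ < u_- is added: for u_+ > u_- the speed would be negative, the profile equation would force decreasing volume between v_- and v_+, and no front from v_- to v_+ exists, so the existence claim in part 1 fails. *)

theory Defs
  imports "HOL-Analysis.Analysis"
begin

definition pressure :: "real \<Rightarrow> real \<Rightarrow> real \<Rightarrow> real" where
  "pressure \<gamma> \<epsilon> v = \<epsilon> * (v - 1) powr (- \<gamma>)"

text \<open>
  Classical solutions \<open>(u, v)\<close>, functions of \<open>(t, x)\<close>, of
  \<open>v_t - u_x = 0\<close>, \<open>u_t + p(v)_x - \<mu> (u_x / v)_x = 0\<close>.
  Every derivative in the system is required to exist pointwise. The pressure law is only
  meaningful for \<open>v > 1\<close>, hence the explicit constraint. Time ranges over the whole line; for
  functions of \<open>x - s t\<close> this is equivalent to restricting to positive times.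
\<close>

definition classical_solution ::
  "real \<Rightarrow> (real \<Rightarrow> real) \<Rightarrow> (real \<Rightarrow> real \<Rightarrow> real) \<Rightarrow> (real \<Rightarrow> real \<Rightarrow> real) \<Rightarrow> bool" where
  "classical_solution \<mu> p u v \<longleftrightarrow>
     (\<exists>v\<^sub>t u\<^sub>t u\<^sub>x q d. \<forall>t x.
        v t x > 1 \<and>
        ((\<lambda>\<tau>. v \<tau> x) has_real_derivative v\<^sub>t t x) (at t) \<and>
        ((\<lambda>\<tau>. u \<tau> x) has_real_derivative u\<^sub>t t x) (at t) \<and>
        ((\<lambda>y. u t y) has_real_derivative u\<^sub>x t x) (at x) \<and>
        ((\<lambda>y. p (v t y)) has_real_derivative q t x) (at x) \<and>
        ((\<lambda>y. 1 / v t y * u\<^sub>x t y) has_real_derivative d t x) (at x) \<and>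
        v\<^sub>t t x - u\<^sub>x t x = 0 \<and>
        u\<^sub>t t x + q t x - \<mu> * d t x = 0)"

definition travelling_wave :: "real \<Rightarrow> (real \<Rightarrow> real) \<Rightarrow> real \<Rightarrow> real \<Rightarrow> real" where
  "travelling_wave s F = (\<lambda>t x. F (x - s * t))"

definition travelling_front ::
  "real \<Rightarrow> (real \<Rightarrow> real) \<Rightarrow> real \<Rightarrow> real \<Rightarrow> real \<Rightarrow> real \<Rightarrow> real \<Rightarrow> (real \<Rightarrow> real) \<Rightarrow> (real \<Rightarrow> real) \<Rightarrow> bool"
where
  "travelling_front \<mu> p v\<^sub>m v\<^sub>p u\<^sub>m u\<^sub>p s U V \<longleftrightarrow>
     classical_solution \<mu> p (travelling_wave s U) (travelling_wave s V) \<and>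
     (\<forall>t. (travelling_wave s V t \<longlongrightarrow> v\<^sub>m) at_bot \<and> (travelling_wave s V t \<longlongrightarrow> v\<^sub>p) at_top \<and>
          (travelling_wave s U t \<longlongrightarrow> u\<^sub>m) at_bot \<and> (travelling_wave s U t \<longlongrightarrow> u\<^sub>p) at_top)"

text \<open>
  End states for which a front is sought. The relation on \<open>(u\<^sub>p - u\<^sub>m)\<^sup>2\<close> leaves the sign of
  \<open>u\<^sub>m - u\<^sub>p\<close> open. Since any front has speed \<open>(u\<^sub>m - u\<^sub>p) / (v\<^sub>p - v\<^sub>m)\<close>, and since for a
  negative speed every heteroclinic orbit of the profile equation runs from the larger to the
  smaller volume, the case \<open>v\<^sub>m < v\<^sub>p\<close> is that of \<open>u\<^sub>p < u\<^sub>m\<close>, i.e. of positive speed.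
\<close>

definition front_states :: "(real \<Rightarrow> real) \<Rightarrow> real \<Rightarrow> real \<Rightarrow> real \<Rightarrow> real \<Rightarrow> bool" where
  "front_states p v\<^sub>m v\<^sub>p u\<^sub>m u\<^sub>p \<longleftrightarrow>
     1 < v\<^sub>m \<and> v\<^sub>m < v\<^sub>p \<and> u\<^sub>p < u\<^sub>m \<and> (u\<^sub>p - u\<^sub>m)\<^sup>2 = - (v\<^sub>p - v\<^sub>m) * (p v\<^sub>p - p v\<^sub>m)"

text \<open>
  \<open>V \<epsilon>\<close> is, for all small \<open>\<epsilon> > 0\<close>, the volume component of a front connecting
  \<open>1 + \<epsilon> powr (1 / \<gamma>)\<close> to the fixed \<open>v\<^sub>p\<close>. The velocities at infinity may depend on \<open>\<epsilon>\<close>, and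
  so may the shift.
\<close>

definition volume_profiles :: "real \<Rightarrow> real \<Rightarrow> real \<Rightarrow> (real \<Rightarrow> real \<Rightarrow> real) \<Rightarrow> bool" where
  "volume_profiles \<mu> \<gamma> v\<^sub>p V \<longleftrightarrow>
     (\<forall>\<^sub>F \<epsilon> in at_right 0. \<exists>u\<^sub>m u\<^sub>p s U.
        front_states (pressure \<gamma> \<epsilon>) (1 + \<epsilon> powr (1 / \<gamma>)) v\<^sub>p u\<^sub>m u\<^sub>p \<and>
        travelling_front \<mu> (pressure \<gamma> \<epsilon>) (1 + \<epsilon> powr (1 / \<gamma>)) v\<^sub>p u\<^sub>m u\<^sub>p s U (V \<epsilon>))"

definition vbar :: "real \<Rightarrow> real \<Rightarrow> real \<Rightarrow> real" where
  "vbar \<mu> v\<^sub>p \<xi> =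
     (let r = v\<^sub>p / (\<mu> * sqrt (v\<^sub>p - 1))
      in if \<xi> < 0 then 1 else v\<^sub>p / (1 + (v\<^sub>p - 1) * exp (- r * \<xi>)))"

text \<open>
  \<open>vbar\<close> has a corner at \<open>0\<close>, so the equation for the velocity profile is imposed away from \<open>0\<close>,
  together with continuity at \<open>0\<close>.
\<close>

definition congested_velocity ::
  "real \<Rightarrow> real \<Rightarrow> real \<Rightarrow> real \<Rightarrow> (real \<Rightarrow> real) \<Rightarrow> bool" where
  "congested_velocity \<mu> v\<^sub>p u\<^sub>m u\<^sub>p ubar \<longleftrightarrow>
     continuous_on UNIV ubar \<and>
     (\<forall>\<xi>. \<xi> \<noteq> 0 \<longrightarrow>
        (ubar has_real_derivative - ((u\<^sub>m - u\<^sub>p) / (v\<^sub>p - 1)) * deriv (vbar \<mu> v\<^sub>p) \<xi>) (at \<xi>)) \<and>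
     (ubar \<longlongrightarrow> u\<^sub>m) at_bot \<and> (ubar \<longlongrightarrow> u\<^sub>p) at_top"

definition pbar :: "real \<Rightarrow> real \<Rightarrow> real \<Rightarrow> real \<Rightarrow> real" where
  "pbar v\<^sub>p u\<^sub>m u\<^sub>p \<xi> = (if \<xi> < 0 then (u\<^sub>m - u\<^sub>p)\<^sup>2 / (v\<^sub>p - 1) else 0)"

definition test_function ::
  "(real \<times> real \<Rightarrow> real) \<Rightarrow> (real \<times> real \<Rightarrow> real) \<Rightarrow> (real \<times> real \<Rightarrow> real) \<Rightarrow> bool" where
  "test_function \<phi> \<phi>\<^sub>t \<phi>\<^sub>x \<longleftrightarrow>
     (\<forall>z. (\<phi> has_derivative (\<lambda>h. \<phi>\<^sub>t z * fst h + \<phi>\<^sub>x z * snd h)) (at z)) \<and>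
     continuous_on UNIV \<phi>\<^sub>t \<and> continuous_on UNIV \<phi>\<^sub>x \<and>
     compact (closure {z. \<phi> z \<noteq> 0})"

definition locally_integrable :: "(real \<Rightarrow> real \<Rightarrow> real) \<Rightarrow> bool" where
  "locally_integrable f \<longleftrightarrow>
     (\<forall>K. compact K \<longrightarrow> set_integrable lborel K (\<lambda>(t, x). f t x))"

definition weak_dx :: "(real \<Rightarrow> real \<Rightarrow> real) \<Rightarrow> (real \<Rightarrow> real \<Rightarrow> real) \<Rightarrow> bool" where
  "weak_dx u w \<longleftrightarrow>
     locally_integrable u \<and> locally_integrable w \<and>
     (\<forall>\<phi> \<phi>\<^sub>t \<phi>\<^sub>x. test_function \<phi> \<phi>\<^sub>t \<phi>\<^sub>x \<longrightarrow>
        (LINT (t, x)|lborel. u t x * \<phi>\<^sub>x (t, x)) = - (LINT (t, x)|lborel. w t x * \<phi> (t, x)))"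

text \<open>
  Solutions of the free-congested system
  \<open>v_t - u_x = 0\<close>, \<open>u_t + p_x - \<mu> (u_x / v)_x = 0\<close>, \<open>v \<ge> 1\<close>, \<open>(v - 1) p = 0\<close>, \<open>p \<ge> 0\<close>.
  At the interface \<open>p\<close> and \<open>u_x\<close> jump, so the two equations are meant in the sense of
  distributions; they are of first order in \<open>u\<close>, \<open>v\<close>, \<open>p\<close>, \<open>u_x / v\<close>, so testing with
  compactly supported \<open>C\<^sup>1\<close> functions is equivalent to testing with smooth ones.
\<close>

definition limit_solution ::
  "real \<Rightarrow> (real \<Rightarrow> real \<Rightarrow> real) \<Rightarrow> (real \<Rightarrow> real \<Rightarrow> real) \<Rightarrow> (real \<Rightarrow> real \<Rightarrow> real) \<Rightarrow> bool" where
  "limit_solution \<mu> u v p \<longleftrightarrow>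
     locally_integrable u \<and> locally_integrable v \<and> locally_integrable p \<and>
     (\<forall>t x. v t x \<ge> 1 \<and> (v t x - 1) * p t x = 0 \<and> p t x \<ge> 0) \<and>
     (\<exists>u\<^sub>x. weak_dx u u\<^sub>x \<and> locally_integrable (\<lambda>t x. 1 / v t x * u\<^sub>x t x) \<and>
        (\<forall>\<phi> \<phi>\<^sub>t \<phi>\<^sub>x. test_function \<phi> \<phi>\<^sub>t \<phi>\<^sub>x \<longrightarrow>
           (LINT (t, x)|lborel. v t x * \<phi>\<^sub>t (t, x) - u t x * \<phi>\<^sub>x (t, x)) = 0 \<and>
           (LINT (t, x)|lborel. u t x * \<phi>\<^sub>t (t, x) + p t x * \<phi>\<^sub>x (t, x)
              - \<mu> * (1 / v t x * u\<^sub>x t x) * \<phi>\<^sub>x (t, x)) = 0))"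

end

theory Submission
  imports Defs "HOL-Complex_Analysis.Conformal_Mappings"
begin

text \<open>
  Mass conservation turns the travelling wave system into \<open>U' = - s V'\<close>, and one integration of
  the momentum equation leaves the scalar equation \<open>V' = g(V)\<close> with
  \<open>g(v) = v / (\<mu> s) (s\<^sup>2 (v\<^sub>m - v) + p(v\<^sub>m) - p(v))\<close>; the integration constant is fixed by the
  end state at \<open>-\<infinity>\<close>, since \<open>V'\<close> must tend to \<open>0\<close> there. By convexity of \<open>p\<close>, \<open>g\<close> is positive
  strictly between its zeros \<open>v\<^sub>m\<close> and \<open>v\<^sub>p\<close>, and separation of variables with the primitive of
  \<open>1 / g\<close> gives existence and uniqueness up to a shift.

  The limit profile satisfies \<open>p - \<mu> u' / v = \<sigma> u + const\<close>, so both conservation laws reduce to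
  the fact that \<open>(\<partial>\<^sub>t + \<sigma> \<partial>\<^sub>x) \<phi>\<close> integrates to zero along the lines \<open>x - \<sigma> t = const\<close>.

  For the decay put \<open>\<delta> = \<epsilon>\<^bsup>1/\<gamma>\<^esup>\<close> and \<open>w = V - v\<^sub>m\<close>. Then \<open>B min(1, w / \<delta>) \<le> w' \<le> A w / \<delta>\<close> on
  the left half-line: going backwards from \<open>0\<close>, \<open>w\<close> falls below \<open>\<delta>\<close> after a distance at most
  \<open>w(0) / B\<close>, which tends to \<open>0\<close>, and decays exponentially from there. Doubling that distance and
  halving the rate absorbs the offset into the exponent.
\<close>

section \<open>Autonomous scalar equations\<close>

text \<open>
  Factoring \<open>g v = (v - z) h v\<close> with \<open>h\<close> continuous makes the equation for \<open>V - z\<close> linear, so that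
  an integrating factor replaces a Gronwall argument.
\<close>

lemma autonomous_ode_zero_invariant:
  fixes V g :: "real \<Rightarrow> real"
  assumes S: "open S" and VS: "\<And>\<xi>. V \<xi> \<in> S"
    and ode: "\<And>\<xi>. (V has_real_derivative g (V \<xi>)) (at \<xi>)"
    and cont: "continuous_on S g"
    and gz: "g z = 0" and gd: "(g has_real_derivative D) (at z)"
    and hit: "V \<xi>\<^sub>0 = z"
  shows "V \<xi> = z"
proof -
  obtain h where h: "\<And>v. g v - g z = h v * (v - z)" "isCont h z"
    using gd unfolding CARAT_DERIV by blast
  \<comment> \<open>Away from \<open>z\<close> the factor is forced to be the difference quotient
    and inherits the continuity of \<open>g\<close>; at \<open>z\<close> its continuity is
    Caratheodory's form of differentiability.\<close>
  have isCont_h: "isCont h v" if "v \<in> S" for v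
  proof (cases "v = z")
    case False
    have ev: "\<forall>\<^sub>F w in nhds v. w \<noteq> z"
      using False t1_space_nhds by blast
    have "isCont (\<lambda>w. (g w - g z) / (w - z)) v"
      using False cont S that by (intro continuous_intros) (auto simp: continuous_on_eq_continuous_at)
    moreover have "\<forall>\<^sub>F w in nhds v. h w = (g w - g z) / (w - z)"
      using ev by eventually_elim (simp add: h(1))
    ultimately show ?thesis
      using isCont_cong by fast
  qed (use h(2) in simp)
  have V_cont: "isCont V \<xi>" for \<xi>
    using ode DERIV_isCont by blast
  have a_cont: "isCont (\<lambda>\<xi>. h (V \<xi>)) \<xi>" for \<xi>
    using isCont_o2[OF V_cont isCont_h[OF VS]] .
  obtain A where A: "\<And>\<xi>. (A has_real_derivative h (V \<xi>)) (at \<xi>)"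
    using einterval_antiderivative[of "-\<infinity>" "\<infinity>" "\<lambda>\<xi>. h (V \<xi>)"] a_cont
    by (auto simp: has_real_derivative_iff_has_vector_derivative)
  have "((\<lambda>\<xi>. (V \<xi> - z) * exp (- A \<xi>)) has_real_derivative 0) (at \<xi>)" for \<xi>
    by (rule derivative_eq_intros ode A refl)+ (use h(1)[of "V \<xi>"] gz in \<open>simp add: mult_ac\<close>)
  then have "(V \<xi> - z) * exp (- A \<xi>) = (V \<xi>\<^sub>0 - z) * exp (- A \<xi>\<^sub>0)"
    by (rule DERIV_isconst_all[rule_format])
  then show ?thesis using hit by simp
qed

text \<open>\<open>H\<close> is the time that a solution of \<open>V' = g(V)\<close> needs to reach
  a level: \<open>H (V \<xi>)\<close> has slope 1 in \<open>\<xi>\<close>. Strict monotonicity, from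
  \<open>1 / g > 0\<close>, is what makes \<open>H\<close> invertible later.\<close>

lemma travel_time:
  fixes g :: "real \<Rightarrow> real"
  assumes ab: "a < b" and cont: "continuous_on {a<..<b} g"
    and pos: "\<And>v. v \<in> {a<..<b} \<Longrightarrow> g v > 0"
  obtains H where "\<And>v. v \<in> {a<..<b} \<Longrightarrow> (H has_real_derivative 1 / g v) (at v)"
    "\<And>v w. v \<in> {a<..<b} \<Longrightarrow> w \<in> {a<..<b} \<Longrightarrow> v < w \<Longrightarrow> H v < H w"
proof -
  have "isCont (\<lambda>v. 1 / g v) v" if "v \<in> {a<..<b}" for v
    using cont pos[OF that] that by (intro continuous_intros) (auto simp: continuous_on_eq_continuous_at)
  then obtain H where H: "\<And>v. v \<in> {a<..<b} \<Longrightarrow> (H has_real_derivative 1 / g v) (at v)"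
    using einterval_antiderivative[of "ereal a" "ereal b" "\<lambda>v. 1 / g v"] ab
    by (auto simp: has_real_derivative_iff_has_vector_derivative einterval_def)
  have H_mono: "H v < H w" if "v \<in> {a<..<b}" "w \<in> {a<..<b}" "v < w" for v w
  proof (rule DERIV_pos_imp_increasing[OF that(3)])
    fix x assume "v \<le> x" "x \<le> w"
    then have "x \<in> {a<..<b}" using that by auto
    then show "\<exists>y. DERIV H x :> y \<and> 0 < y" using H pos by (meson zero_less_divide_1_iff)
  qed
  then show thesis
    using that H by blast
qed

text \<open>Composed with the travel time, every solution becomes \<open>\<xi>\<close> plus a
  constant. Two solutions thus differ only in that constant, and injectivity of \<open>H\<close>
  turns the difference of constants into the shift \<open>C\<close>.\<close>

lemma autonomous_ode_unique_up_to_shift: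
  fixes V W g :: "real \<Rightarrow> real"
  assumes cont: "continuous_on {a<..<b} g" and pos: "\<And>v. v \<in> {a<..<b} \<Longrightarrow> g v > 0"
    and V: "\<And>\<xi>. V \<xi> \<in> {a<..<b}" "\<And>\<xi>. (V has_real_derivative g (V \<xi>)) (at \<xi>)"
    and W: "\<And>\<xi>. W \<xi> \<in> {a<..<b}" "\<And>\<xi>. (W has_real_derivative g (W \<xi>)) (at \<xi>)"
  obtains C where "\<And>\<xi>. W \<xi> = V (\<xi> + C)"
proof -
  have ab: "a < b" using V(1)[of 0] by auto
  obtain H where H: "\<And>v. v \<in> {a<..<b} \<Longrightarrow> (H has_real_derivative 1 / g v) (at v)"
    and H_mono: "\<And>v w. v \<in> {a<..<b} \<Longrightarrow> w \<in> {a<..<b} \<Longrightarrow> v < w \<Longrightarrow> H v < H w"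
    using travel_time[OF ab cont pos] by blast
  have time: "H (X \<xi>) = \<xi> + H (X 0)"
    if X: "\<And>\<xi>. X \<xi> \<in> {a<..<b}" "\<And>\<xi>. (X has_real_derivative g (X \<xi>)) (at \<xi>)" for X \<xi>
  proof -
    have "((\<lambda>\<xi>. H (X \<xi>) - \<xi>) has_real_derivative 1 / g (X \<xi>) * g (X \<xi>) - 1) (at \<xi>)" for \<xi>
      by (intro DERIV_diff DERIV_chain2[OF H] X DERIV_ident)
    moreover have "1 / g (X \<xi>) * g (X \<xi>) - 1 = 0" for \<xi>
      using pos[OF X(1), of \<xi>] by simp
    ultimately have "((\<lambda>\<xi>. H (X \<xi>) - \<xi>) has_real_derivative 0) (at \<xi>)" for \<xi>
      by metis
    then have "H (X \<xi>) - \<xi> = H (X 0) - 0"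
      by (rule DERIV_isconst_all[rule_format])
    then show ?thesis by simp
  qed
  have "W \<xi> = V (\<xi> + (H (W 0) - H (V 0)))" for \<xi>
  proof -
    have "H (W \<xi>) = H (V (\<xi> + (H (W 0) - H (V 0))))"
      using time[OF W, of \<xi>] time[OF V, of "\<xi> + (H (W 0) - H (V 0))"] by linarith
    then show ?thesis
      using H_mono[OF W(1)[of \<xi>] V(1)[of "\<xi> + (H (W 0) - H (V 0))"]]
        H_mono[OF V(1)[of "\<xi> + (H (W 0) - H (V 0))"] W(1)[of \<xi>]] by linarith
  qed
  then show thesis using that by blast
qed

text \<open>The factor \<open>h\<close> in \<open>g v = h v * (v - z)\<close> is continuous on the
  compact interval, hence bounded; the bound is \<open>L\<close>.\<close>

lemma linear_bound_at_zero:
  fixes g :: "real \<Rightarrow> real"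
  assumes "continuous_on {a..b} g" "z \<in> {a..b}" "g z = 0" "(g has_real_derivative D) (at z)"
  obtains L where "L > 0" "\<And>v. v \<in> {a..b} \<Longrightarrow> \<bar>g v\<bar> \<le> L * \<bar>v - z\<bar>"
proof -
  obtain h where h: "\<And>v. g v - g z = h v * (v - z)" "isCont h z"
    using assms(4) unfolding CARAT_DERIV by blast
  have "continuous (at v within {a..b}) h" if "v \<in> {a..b}" for v
  proof (cases "v = z")
    case False
    have c: "continuous (at v within {a..b}) (\<lambda>w. (g w - g z) / (w - z))"
      using False assms(1) that by (intro continuous_intros) (auto simp: continuous_on_eq_continuous_within)
    have "\<forall>\<^sub>F w in nhds v. w \<noteq> z"
      using False t1_space_nhds by blast
    then have "\<forall>\<^sub>F w in at v within {a..b}. (g w - g z) / (w - z) = h w"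
      unfolding eventually_at_filter by eventually_elim (simp add: h(1))
    then show ?thesis
      using c False unfolding continuous_within
      by (subst tendsto_cong[symmetric]) (auto simp: h(1))
  qed (use h(2) in \<open>simp add: continuous_at_imp_continuous_at_within\<close>)
  then have "compact (h ` {a..b})"
    by (intro compact_continuous_image) (auto simp: continuous_on_eq_continuous_within)
  then have "bounded (h ` {a..b})"
    by (rule compact_imp_bounded)
  then obtain L where L: "L > 0" "\<And>v. v \<in> {a..b} \<Longrightarrow> \<bar>h v\<bar> \<le> L"
    unfolding bounded_pos by auto
  have "\<bar>g v\<bar> \<le> L * \<bar>v - z\<bar>" if "v \<in> {a..b}" for v
    using h(1)[of v] assms(3) L(2)[OF that] by (simp add: abs_mult mult_right_mono)
  then show thesis using L(1) that by blast
qed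

text \<open>The linear bound at the zeros makes the travel time to either of them infinite.\<close>

lemma autonomous_ode_heteroclinic:
  fixes g :: "real \<Rightarrow> real"
  assumes ab: "a < b" and cont: "continuous_on {a..b} g"
    and pos: "\<And>v. v \<in> {a<..<b} \<Longrightarrow> g v > 0"
    and ga: "g a = 0" "(g has_real_derivative D) (at a)"
    and gb: "g b = 0" "(g has_real_derivative E) (at b)"
  obtains V where "\<And>\<xi>. V \<xi> \<in> {a<..<b}" "\<And>\<xi>. (V has_real_derivative g (V \<xi>)) (at \<xi>)"
    "(V \<longlongrightarrow> a) at_bot" "(V \<longlongrightarrow> b) at_top"
proof -
  have cont_open: "continuous_on {a<..<b} g"
    using cont by (rule continuous_on_subset) auto
  obtain H where H: "\<And>v. v \<in> {a<..<b} \<Longrightarrow> (H has_real_derivative 1 / g v) (at v)"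
    and H_mono: "\<And>v w. v \<in> {a<..<b} \<Longrightarrow> w \<in> {a<..<b} \<Longrightarrow> v < w \<Longrightarrow> H v < H w"
    using travel_time[OF ab cont_open pos] by blast
  have H_cont: "continuous_on {a<..<b} H"
    by (meson DERIV_isCont H continuous_at_imp_continuous_on)
  obtain L where L: "L > 0" "\<And>v. v \<in> {a..b} \<Longrightarrow> \<bar>g v\<bar> \<le> L * \<bar>v - a\<bar>"
    using linear_bound_at_zero[OF cont _ ga] ab by auto
  obtain M where M: "M > 0" "\<And>v. v \<in> {a..b} \<Longrightarrow> \<bar>g v\<bar> \<le> M * \<bar>v - b\<bar>"
    using linear_bound_at_zero[OF cont _ gb] ab by auto
  define c where "c = (a + b) / 2"
  have c: "a < c" "c < b" using ab by (auto simp: c_def)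
  \<comment> \<open>Since \<open>1 / g x \<ge> 1 / (L * (x - a))\<close>, the time between a level
    and \<open>c\<close> is at least a logarithm divided by \<open>L\<close>. The level at distance
    \<open>(c - a) * exp (- N)\<close> from \<open>a\<close> makes this time exactly
    \<open>N / L\<close>, unbounded in \<open>N\<close>.\<close>
  have low: "H (a + (c - a) * exp (- N)) \<le> H c - N / L"
    and low_mem: "a + (c - a) * exp (- N) \<in> {a<..<b}" if "N \<ge> 0" for N
  proof -
    define v where "v = a + (c - a) * exp (- N)"
    have sub: "v - a = (c - a) * exp (- N)"
      by (simp add: v_def)
    have v: "a < v" "v \<le> c"
      using c mult_left_le[of "exp (- N)" "c - a"] that mult_pos_pos[of "c - a" "exp (- N)"]
      by (smt (verit) sub exp_gt_zero exp_le_one_iff)+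
    then show "a + (c - a) * exp (- N) \<in> {a<..<b}" unfolding v_def[symmetric] using c by auto
    have "H v - ln (v - a) / L \<le> H c - ln (c - a) / L"
    proof (rule DERIV_nonneg_imp_nondecreasing[OF v(2)])
      fix x assume "v \<le> x" "x \<le> c"
      then have x: "x \<in> {a<..<b}" using v c by auto
      have "((\<lambda>v. H v - ln (v - a) / L) has_real_derivative (1 / g x - 1 / (x - a) / L)) (at x)"
        using x L(1) by (auto intro!: derivative_eq_intros H)
      moreover have "1 / g x - 1 / (x - a) / L \<ge> 0"
        using L(2)[of x] L(1) pos[OF x] x by (simp add: field_simps)
      ultimately show "\<exists>y. ((\<lambda>v. H v - ln (v - a) / L) has_real_derivative y) (at x) \<and> 0 \<le> y" by blast
    qed
    then show "H (a + (c - a) * exp (- N)) \<le> H c - N / L"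
      unfolding v_def[symmetric] sub
      using c L(1) by (simp add: ln_mult diff_divide_distrib)
  qed
  \<comment> \<open>The mirror image at \<open>b\<close>, with the bound \<open>M\<close>.\<close>
  have high: "H (b - (b - c) * exp (- N)) \<ge> H c + N / M"
    and high_mem: "b - (b - c) * exp (- N) \<in> {a<..<b}" if "N \<ge> 0" for N
  proof -
    define v where "v = b - (b - c) * exp (- N)"
    have sub: "b - v = (b - c) * exp (- N)"
      by (simp add: v_def)
    have v: "v < b" "c \<le> v"
      using c mult_left_le[of "exp (- N)" "b - c"] that mult_pos_pos[of "b - c" "exp (- N)"]
      by (smt (verit) sub exp_gt_zero exp_le_one_iff)+
    then show "b - (b - c) * exp (- N) \<in> {a<..<b}" unfolding v_def[symmetric] using c by auto
    have "H c + ln (b - c) / M \<le> H v + ln (b - v) / M"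
    proof (rule DERIV_nonneg_imp_nondecreasing[OF v(2)])
      fix x assume "c \<le> x" "x \<le> v"
      then have x: "x \<in> {a<..<b}" using v c by auto
      have "((\<lambda>v. H v + ln (b - v) / M) has_real_derivative (1 / g x + - 1 / (b - x) / M)) (at x)"
        using x M(1) by (auto intro!: derivative_eq_intros H)
      moreover have "1 / g x + - 1 / (b - x) / M \<ge> 0"
        using M(2)[of x] M(1) pos[OF x] x by (simp add: field_simps)
      ultimately show "\<exists>y. ((\<lambda>v. H v + ln (b - v) / M) has_real_derivative y) (at x) \<and> 0 \<le> y" by blast
    qed
    then show "H c + N / M \<le> H (b - (b - c) * exp (- N))"
      unfolding v_def[symmetric] sub
      using c M(1) by (simp add: ln_mult diff_divide_distrib)
  qed
  have "\<exists>v\<in>{a<..<b}. H v = \<xi>" for \<xi>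
  proof -
    \<comment> \<open>\<open>N1\<close> and \<open>N2\<close> are large enough for the two
      logarithmic bounds to enclose \<open>\<xi>\<close>; the maximum with 0 keeps the levels inside
      the interval. The intermediate value theorem then makes \<open>H\<close> surjective.\<close>
    define N1 where "N1 = max 0 (L * (H c - \<xi>))"
    define N2 where "N2 = max 0 (M * (\<xi> - H c))"
    let ?v1 = "a + (c - a) * exp (- N1)" and ?v2 = "b - (b - c) * exp (- N2)"
    have N: "N1 \<ge> 0" "N2 \<ge> 0" by (auto simp: N1_def N2_def)
    have "H c - N1 / L \<le> \<xi>" "\<xi> \<le> H c + N2 / M"
      using L(1) M(1) by (auto simp: N1_def N2_def field_simps max_def)
    then have "H ?v1 \<le> \<xi>" "\<xi> \<le> H ?v2"
      using low[OF N(1)] high[OF N(2)] by linarith+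
    moreover have "connected (H ` {a<..<b})"
      by (rule connected_continuous_image[OF H_cont]) simp
    ultimately have "\<xi> \<in> H ` {a<..<b}"
      using connectedD_interval[of "H ` {a<..<b}" "H ?v1" "H ?v2" \<xi>]
        low_mem[OF N(1)] high_mem[OF N(2)] by (simp only: imageI)
    then show ?thesis by auto
  qed
  then obtain V where V: "\<And>\<xi>. V \<xi> \<in> {a<..<b}" "\<And>\<xi>. H (V \<xi>) = \<xi>"
    by metis
  have VH: "V (H v) = v" if "v \<in> {a<..<b}" for v
    using H_mono[OF that V(1)[of "H v"]] H_mono[OF V(1)[of "H v"] that] V(2)[of "H v"] by linarith
  have dV: "(V has_real_derivative g (V \<xi>)) (at \<xi>)" for \<xi>
  proof -
    \<comment> \<open>\<open>V\<close> is the inverse function of \<open>H\<close>, so its slope is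
      the reciprocal of \<open>1 / g\<close>, which is the differential equation.\<close>
    have "(V has_real_derivative inverse (1 / g (V \<xi>))) (at \<xi>)"
      using pos[OF V(1)[of \<xi>]]
      by (intro has_field_derivative_inverse_strong_x[OF H[OF V(1)] _ _ H_cont V(1) V(2) VH]) auto
    then show ?thesis by simp
  qed
  have V_mono: "V \<xi> \<le> V \<eta>" if "\<xi> \<le> \<eta>" for \<xi> \<eta>
    using H_mono[OF V(1)[of \<eta>] V(1)[of \<xi>]] V(2)[of \<xi>] V(2)[of \<eta>] that by linarith
  \<comment> \<open>\<open>V\<close> is nondecreasing and takes every value \<open>v\<close> in the
    open interval, namely at time \<open>H v\<close>. Its limits are therefore the two ends.\<close>
  have "(V \<longlongrightarrow> a) at_bot"
  proof (rule order_tendstoI)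
    fix y assume "y < a" then show "\<forall>\<^sub>F \<xi> in at_bot. y < V \<xi>"
      using V(1) by (intro always_eventually) (force dest: less_trans)
  next
    fix y assume "a < y"
    then obtain v where v: "a < v" "v < min y b" using ab dense[of a "min y b"] by auto
    then have "V \<xi> < y" if "\<xi> \<le> H v" for \<xi>
      using V_mono[OF that] VH[of v] by auto
    then show "\<forall>\<^sub>F \<xi> in at_bot. V \<xi> < y" unfolding eventually_at_bot_linorder by blast
  qed
  moreover have "(V \<longlongrightarrow> b) at_top"
  proof (rule order_tendstoI)
    fix y assume "y > b" then show "\<forall>\<^sub>F \<xi> in at_top. V \<xi> < y"
      using V(1) by (intro always_eventually) (force dest: less_trans)
  next
    fix y assume "y < b"
    then obtain v where v: "max y a < v" "v < b" using ab dense[of "max y a" b] by auto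
    then have "y < V \<xi>" if "\<xi> \<ge> H v" for \<xi>
      using V_mono[OF that] VH[of v] by auto
    then show "\<forall>\<^sub>F \<xi> in at_top. y < V \<xi>" unfolding eventually_at_top_linorder by blast
  qed
  ultimately show thesis using that V(1) dV by blast
qed

section \<open>Viscous shock profiles\<close>

lemma pressure_has_derivative:
  assumes "v > 1"
  shows "(pressure \<gamma> \<epsilon> has_real_derivative - (\<gamma> * \<epsilon> * (v - 1) powr (- \<gamma> - 1))) (at v)"
  unfolding pressure_def using assms by (auto intro!: derivative_eq_intros simp: field_simps)

lemma filterlim_plus_const_at_bot: "filterlim (\<lambda>x. x + c :: real) at_bot at_bot"
  using filterlim_tendsto_add_at_bot_iff[OF tendsto_const[of c at_bot], of "\<lambda>x. x"]
  by (simp add: add.commute filterlim_ident)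

text \<open>By the mean value theorem the increments over unit intervals are values of
  \<open>f'\<close> at points drifting to \<open>-\<infinity>\<close>. The increments tend to 0,
  those values to \<open>D\<close>. This later removes the integration constant of the momentum
  equation.\<close>

lemma tendsto_deriv_at_bot_eq_0:
  fixes f f' :: "real \<Rightarrow> real"
  assumes "\<And>x. (f has_real_derivative f' x) (at x)"
    and "(f \<longlongrightarrow> L) at_bot" "(f' \<longlongrightarrow> D) at_bot"
  shows "D = 0"
proof -
  have "\<exists>z. x < z \<and> z < x + 1 \<and> f (x + 1) - f x = f' z" for x
    using MVT2[of x "x + 1" f f'] assms(1) by auto
  then obtain z where z: "\<And>x. x < z x" "\<And>x. z x < x + 1" "\<And>x. f (x + 1) - f x = f' (z x)"
    by metis
  have "filterlim z at_bot at_bot"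
    by (rule filterlim_at_bot_mono[OF filterlim_plus_const_at_bot[of 1]]) (use z(2) in \<open>auto intro: less_imp_le always_eventually\<close>)
  then have "((\<lambda>x. f' (z x)) \<longlongrightarrow> D) at_bot"
    using assms(3) filterlim_compose by blast
  moreover have "((\<lambda>x. f (x + 1) - f x) \<longlongrightarrow> L - L) at_bot"
    by (intro tendsto_diff assms filterlim_compose[OF assms(2) filterlim_plus_const_at_bot])
  ultimately have "((\<lambda>x. f (x + 1) - f x) \<longlongrightarrow> D) at_bot" "((\<lambda>x. f (x + 1) - f x) \<longlongrightarrow> 0) at_bot"
    using z(3) by simp_all
  then show ?thesis
    using tendsto_unique trivial_limit_at_bot_linorder by blast
qed

section \<open>The profile equation under the Rankine-Hugoniot condition\<close>

locale viscous_shock =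
  fixes \<mu> \<gamma> \<epsilon> v\<^sub>m v\<^sub>p s :: real
  assumes mu: "\<mu> > 0" and gamma: "\<gamma> > 0" and eps: "\<epsilon> > 0" and vm: "1 < v\<^sub>m" and vmp: "v\<^sub>m < v\<^sub>p"
    and s: "s > 0" and rankine_hugoniot: "s\<^sup>2 * (v\<^sub>p - v\<^sub>m) = pressure \<gamma> \<epsilon> v\<^sub>m - pressure \<gamma> \<epsilon> v\<^sub>p"
begin

text \<open>The height of a chord above the graph of the pressure: by Rankine-Hugoniot, the line of
  slope \<open>- s\<^sup>2\<close> through the left state also meets the graph at the right
  state.\<close>

definition chord_gap :: "real \<Rightarrow> real" where
  "chord_gap v = s\<^sup>2 * (v\<^sub>m - v) + pressure \<gamma> \<epsilon> v\<^sub>m - pressure \<gamma> \<epsilon> v"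

definition profile_field :: "real \<Rightarrow> real" where
  "profile_field v = v / (\<mu> * s) * chord_gap v"

lemma chord_gap_ends: "chord_gap v\<^sub>m = 0" "chord_gap v\<^sub>p = 0"
  using rankine_hugoniot by (auto simp: chord_gap_def algebra_simps)

lemma chord_gap_deriv:
  assumes "v > 1"
  shows "(chord_gap has_real_derivative (\<gamma> * \<epsilon> * (v - 1) powr (- \<gamma> - 1) - s\<^sup>2)) (at v)"
  unfolding chord_gap_def using assms
  by (auto intro!: derivative_eq_intros pressure_has_derivative)

text \<open>Strict concavity of the gap: a value \<open>\<le> 0\<close> between the two zeros would
  give a slope \<open>\<le> 0\<close> at some \<open>z\<close> on the left and a slope
  \<open>\<ge> 0\<close> at some \<open>w\<close> on the right, but the slope decreases
  strictly.\<close>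

lemma chord_gap_pos:
  assumes "v\<^sub>m < v" "v < v\<^sub>p"
  shows "chord_gap v > 0"
proof (rule ccontr)
  let ?d = "\<lambda>v. \<gamma> * \<epsilon> * (v - 1) powr (- \<gamma> - 1) - s\<^sup>2"
  assume "\<not> chord_gap v > 0"
  then have neg: "chord_gap v \<le> 0" by simp
  have "\<exists>z. v\<^sub>m < z \<and> z < v \<and> chord_gap v - chord_gap v\<^sub>m = (v - v\<^sub>m) * ?d z"
    using assms vm by (intro MVT2 chord_gap_deriv) auto
  then obtain z where z: "v\<^sub>m < z" "z < v" "chord_gap v = (v - v\<^sub>m) * ?d z"
    using chord_gap_ends by auto
  have "\<exists>w. v < w \<and> w < v\<^sub>p \<and> chord_gap v\<^sub>p - chord_gap v = (v\<^sub>p - v) * ?d w"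
    using assms vm by (intro MVT2 chord_gap_deriv) auto
  then obtain w where w: "v < w" "w < v\<^sub>p" "- chord_gap v = (v\<^sub>p - v) * ?d w"
    using chord_gap_ends by auto
  have "?d z \<le> 0"
    using z assms neg by (simp add: mult_le_0_iff)
  moreover have "0 \<le> (v\<^sub>p - v) * ?d w"
    using w(3) neg by linarith
  then have "?d w \<ge> 0"
    using assms(2) by (simp add: zero_le_mult_iff)
  moreover have "(w - 1) powr (- \<gamma> - 1) < (z - 1) powr (- \<gamma> - 1)"
    using z w vm gamma by (intro powr_less_mono2_neg) auto
  then have "?d w < ?d z"
    using gamma eps by simp
  ultimately show False by linarith
qed

lemma profile_field_ends: "profile_field v\<^sub>m = 0" "profile_field v\<^sub>p = 0"
  by (simp_all add: profile_field_def chord_gap_ends)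

lemma profile_field_pos: "v\<^sub>m < v \<Longrightarrow> v < v\<^sub>p \<Longrightarrow> profile_field v > 0"
  using chord_gap_pos mu s vm by (auto simp: profile_field_def)

lemma profile_field_differentiable:
  assumes "v > 1"
  obtains D where "(profile_field has_real_derivative D) (at v)"
proof -
  have "(profile_field has_real_derivative
      (1 / (\<mu> * s) * chord_gap v + (\<gamma> * \<epsilon> * (v - 1) powr (- \<gamma> - 1) - s\<^sup>2) * (v / (\<mu> * s)))) (at v)"
    unfolding profile_field_def by (intro DERIV_mult chord_gap_deriv assms DERIV_cdivide DERIV_ident)
  then show thesis using that by blast
qed

lemma continuous_on_profile_field: "continuous_on {1<..} profile_field"
  by (meson DERIV_isCont continuous_at_imp_continuous_on greaterThan_iff profile_field_differentiable)

lemma profile_exists: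
  obtains V where "\<And>\<xi>. V \<xi> \<in> {v\<^sub>m<..<v\<^sub>p}"
    "\<And>\<xi>. (V has_real_derivative profile_field (V \<xi>)) (at \<xi>)"
    "(V \<longlongrightarrow> v\<^sub>m) at_bot" "(V \<longlongrightarrow> v\<^sub>p) at_top"
proof -
  obtain D where D: "(profile_field has_real_derivative D) (at v\<^sub>m)"
    using profile_field_differentiable vm by blast
  obtain E where E: "(profile_field has_real_derivative E) (at v\<^sub>p)"
    using profile_field_differentiable vm vmp by (meson less_trans)
  have "continuous_on {v\<^sub>m..v\<^sub>p} profile_field"
    using continuous_on_profile_field by (rule continuous_on_subset) (use vm in auto)
  then show thesis
    by (rule autonomous_ode_heteroclinic[OF vmp _ _ profile_field_ends(1) D profile_field_ends(2) E])
       (use profile_field_pos that in auto)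
qed

text \<open>A solution that touches one of the end states is constant by
  \<open>autonomous_ode_zero_invariant\<close>, which contradicts its two different limits. So the
  connected range omits \<open>v\<^sub>m\<close> and \<open>v\<^sub>p\<close>. As some value exceeds
  \<open>v\<^sub>m\<close> and some value lies below \<open>v\<^sub>p\<close>, everything stays
  strictly between them.\<close>

lemma profile_range:
  assumes V: "\<And>\<xi>. V \<xi> > 1" "\<And>\<xi>. (V has_real_derivative profile_field (V \<xi>)) (at \<xi>)"
    and lim: "(V \<longlongrightarrow> v\<^sub>m) at_bot" "(V \<longlongrightarrow> v\<^sub>p) at_top"
  shows "V \<xi> \<in> {v\<^sub>m<..<v\<^sub>p}"
proof -
  have avoid: "z \<notin> range V" if z: "z > 1" "profile_field z = 0" for z
  proof
    assume "z \<in> range V"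
    then obtain \<xi>\<^sub>0 where hit: "V \<xi>\<^sub>0 = z" by auto
    obtain D where D: "(profile_field has_real_derivative D) (at z)"
      using profile_field_differentiable z(1) by blast
    have "V = (\<lambda>_. z)"
      using autonomous_ode_zero_invariant[OF _ _ V(2) continuous_on_profile_field z(2) D hit] V(1) by auto
    then have "v\<^sub>m = z" "v\<^sub>p = z"
      using lim by (simp_all add: tendsto_const_iff)
    then show False using vmp by simp
  qed
  have "connected (range V)"
    using V(2) by (intro connected_continuous_image continuous_at_imp_continuous_on)
      (auto intro: DERIV_isCont)
  note ivt = connectedD_interval[OF this]
  have "\<forall>\<^sub>F \<eta> in at_top. V \<eta> > v\<^sub>m" "\<forall>\<^sub>F \<eta> in at_bot. V \<eta> < v\<^sub>p"
    using lim vmp order_tendstoD by blast+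
  then obtain \<eta> \<zeta> where "V \<eta> > v\<^sub>m" "V \<zeta> < v\<^sub>p"
    by (meson eventually_happens trivial_limit_at_top_linorder trivial_limit_at_bot_linorder)
  moreover have "v\<^sub>m \<notin> range V" "v\<^sub>p \<notin> range V"
    using avoid vm vmp profile_field_ends by auto
  ultimately have "\<not> V \<xi> \<le> v\<^sub>m" "\<not> V \<xi> \<ge> v\<^sub>p"
    using ivt[of "V \<xi>" "V \<eta>" v\<^sub>m] ivt[of "V \<zeta>" "V \<xi>" v\<^sub>p] by auto
  then show ?thesis by auto
qed

lemma profile_unique_up_to_shift:
  assumes "\<And>\<xi>. V \<xi> \<in> {v\<^sub>m<..<v\<^sub>p}" "\<And>\<xi>. (V has_real_derivative profile_field (V \<xi>)) (at \<xi>)"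
    and "\<And>\<xi>. W \<xi> \<in> {v\<^sub>m<..<v\<^sub>p}" "\<And>\<xi>. (W has_real_derivative profile_field (W \<xi>)) (at \<xi>)"
  obtains C where "\<And>\<xi>. W \<xi> = V (\<xi> + C)"
proof -
  have "continuous_on {v\<^sub>m<..<v\<^sub>p} profile_field"
    using continuous_on_profile_field by (rule continuous_on_subset) (use vm in auto)
  then show thesis
    using autonomous_ode_unique_up_to_shift[OF _ _ assms] profile_field_pos that by auto
qed

text \<open>The velocity is obtained by integrating mass conservation \<open>U' = - s V'\<close>
  from the left state; the assumption on \<open>u\<^sub>p\<close> is what makes it arrive at the
  right state.\<close>

lemma profile_travelling_front:
  assumes V: "\<And>\<xi>. V \<xi> \<in> {v\<^sub>m<..<v\<^sub>p}" "\<And>\<xi>. (V has_real_derivative profile_field (V \<xi>)) (at \<xi>)"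
    and lim: "(V \<longlongrightarrow> v\<^sub>m) at_bot" "(V \<longlongrightarrow> v\<^sub>p) at_top"
    and up: "u\<^sub>p = u\<^sub>m - s * (v\<^sub>p - v\<^sub>m)"
  shows "travelling_front \<mu> (pressure \<gamma> \<epsilon>) v\<^sub>m v\<^sub>p u\<^sub>m u\<^sub>p s (\<lambda>\<xi>. u\<^sub>m - s * (V \<xi> - v\<^sub>m)) V"
proof -
  let ?U = "\<lambda>\<xi>. u\<^sub>m - s * (V \<xi> - v\<^sub>m)"
  define g where "g \<xi> = profile_field (V \<xi>)" for \<xi>
  define q where "q \<xi> = - (\<gamma> * \<epsilon> * (V \<xi> - 1) powr (- \<gamma> - 1)) * g \<xi>" for \<xi>
  have V1: "V \<xi> > 1" for \<xi> using V(1)[of \<xi>] vm by auto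
  have dV: "(V has_real_derivative g \<xi>) (at \<xi>)" for \<xi>
    using V(2) by (simp add: g_def)
  have dU: "(?U has_real_derivative - s * g \<xi>) (at \<xi>)" for \<xi>
    by (auto intro!: derivative_eq_intros dV)
  have dp: "((\<lambda>\<xi>. pressure \<gamma> \<epsilon> (V \<xi>)) has_real_derivative q \<xi>) (at \<xi>)" for \<xi>
    unfolding q_def by (rule DERIV_chain2[where f = "pressure \<gamma> \<epsilon>", OF pressure_has_derivative[OF V1] dV])
  \<comment> \<open>On a profile the viscous term \<open>u_x / v\<close> is a multiple of
    \<open>chord_gap (V \<xi>)\<close>. It is thus differentiable as a function of \<open>V\<close>
    alone, and its derivative balances the momentum equation.\<close>
  have "1 / V \<xi> * (- s * g \<xi>) = - 1 / \<mu> * chord_gap (V \<xi>)" for \<xi>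
    using V1[of \<xi>] mu s by (simp add: g_def profile_field_def)
  moreover have "((\<lambda>\<xi>. - 1 / \<mu> * chord_gap (V \<xi>)) has_real_derivative (s\<^sup>2 * g \<xi> + q \<xi>) / \<mu>) (at \<xi>)" for \<xi>
    unfolding chord_gap_def
    using mu by (auto intro!: derivative_eq_intros dV dp simp: field_simps power2_eq_square)
  ultimately have dd: "((\<lambda>\<xi>. 1 / V \<xi> * (- s * g \<xi>)) has_real_derivative (s\<^sup>2 * g \<xi> + q \<xi>) / \<mu>) (at \<xi>)" for \<xi>
    by presburger
  have shift: "((\<lambda>y. y - s * t) has_real_derivative 1) (at x)" for t x
    by (auto intro!: derivative_eq_intros)
  have flow: "((\<lambda>\<tau>. x - s * \<tau>) has_real_derivative - s) (at t)" for t x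
    by (auto intro!: derivative_eq_intros)
  have "classical_solution \<mu> (pressure \<gamma> \<epsilon>) (travelling_wave s ?U) (travelling_wave s V)"
    unfolding classical_solution_def travelling_wave_def
  proof (intro exI allI conjI)
    fix t x
    show "1 < V (x - s * t)" by (rule V1)
    show "((\<lambda>\<tau>. V (x - s * \<tau>)) has_real_derivative g (x - s * t) * - s) (at t)"
      by (rule DERIV_chain2[OF dV flow])
    show "((\<lambda>\<tau>. ?U (x - s * \<tau>)) has_real_derivative - s * g (x - s * t) * - s) (at t)"
      by (rule DERIV_chain2[OF dU flow])
    show "((\<lambda>y. ?U (y - s * t)) has_real_derivative - s * g (x - s * t) * 1) (at x)"
      by (rule DERIV_chain2[OF dU shift])
    show "((\<lambda>y. pressure \<gamma> \<epsilon> (V (y - s * t))) has_real_derivative q (x - s * t) * 1) (at x)"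
      by (rule DERIV_chain2[OF dp shift])
    show "((\<lambda>y. 1 / V (y - s * t) * (- s * g (y - s * t) * 1)) has_real_derivative
        (s\<^sup>2 * g (x - s * t) + q (x - s * t)) / \<mu> * 1) (at x)"
      using DERIV_chain2[OF dd shift] by simp
    show "g (x - s * t) * - s - - s * g (x - s * t) * 1 = 0" by simp
    show "- s * g (x - s * t) * - s + q (x - s * t) * 1
        - \<mu> * ((s\<^sup>2 * g (x - s * t) + q (x - s * t)) / \<mu> * 1) = 0"
      using mu by (simp add: power2_eq_square)
  qed
  moreover have bot: "filterlim (\<lambda>x. x - s * t) at_bot at_bot" for t
    using filterlim_plus_const_at_bot[of "- (s * t)"] by simp
  moreover have top: "filterlim (\<lambda>x. x - s * t) at_top at_top" for t
    using filterlim_tendsto_add_at_top[OF tendsto_const filterlim_ident, of "- (s * t)"] by simp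
  moreover have "(?U \<longlongrightarrow> u\<^sub>m - s * (v\<^sub>m - v\<^sub>m)) at_bot" "(?U \<longlongrightarrow> u\<^sub>m - s * (v\<^sub>p - v\<^sub>m)) at_top"
    by (intro tendsto_intros lim)+
  then have "(?U \<longlongrightarrow> u\<^sub>m) at_bot" "(?U \<longlongrightarrow> u\<^sub>p) at_top" by (simp_all add: up)
  ultimately show ?thesis
    unfolding travelling_front_def travelling_wave_def
    by (auto intro: filterlim_compose[OF lim(1)] filterlim_compose[OF lim(2)]
        filterlim_compose[of ?U _ at_bot] filterlim_compose[of ?U _ at_top])
qed

end

text \<open>The converse direction: a front, known only as a pointwise solution with limits, has the
  speed dictated by mass conservation and solves the profile equation. Both conservation laws are
  integrated once, and the limits fix the constants.\<close>

lemma travelling_front_profile: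
  assumes mu: "\<mu> > 0" and gamma: "\<gamma> > 0" and eps: "\<epsilon> > 0"
    and states: "front_states (pressure \<gamma> \<epsilon>) v\<^sub>m v\<^sub>p u\<^sub>m u\<^sub>p"
    and front: "travelling_front \<mu> (pressure \<gamma> \<epsilon>) v\<^sub>m v\<^sub>p u\<^sub>m u\<^sub>p s U V"
  shows "s = (u\<^sub>m - u\<^sub>p) / (v\<^sub>p - v\<^sub>m)"
    and "viscous_shock \<mu> \<gamma> \<epsilon> v\<^sub>m v\<^sub>p s"
    and "U \<xi> = u\<^sub>m - s * (V \<xi> - v\<^sub>m)"
    and "(V has_real_derivative viscous_shock.profile_field \<mu> \<gamma> \<epsilon> v\<^sub>m s (V \<xi>)) (at \<xi>)"
    and "V \<xi> \<in> {v\<^sub>m<..<v\<^sub>p}"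
proof -
  let ?p = "pressure \<gamma> \<epsilon>"
  from states have vm: "1 < v\<^sub>m" and vmp: "v\<^sub>m < v\<^sub>p" and u: "u\<^sub>p < u\<^sub>m"
    and jump: "(u\<^sub>p - u\<^sub>m)\<^sup>2 = - (v\<^sub>p - v\<^sub>m) * (?p v\<^sub>p - ?p v\<^sub>m)"
    by (auto simp: front_states_def)
  from front have cs: "classical_solution \<mu> ?p (travelling_wave s U) (travelling_wave s V)"
    and "\<forall>t. (travelling_wave s V t \<longlongrightarrow> v\<^sub>m) at_bot \<and> (travelling_wave s V t \<longlongrightarrow> v\<^sub>p) at_top \<and>
          (travelling_wave s U t \<longlongrightarrow> u\<^sub>m) at_bot \<and> (travelling_wave s U t \<longlongrightarrow> u\<^sub>p) at_top"
    by (auto simp: travelling_front_def)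
  from this(2)[rule_format, of 0] have lim: "(V \<longlongrightarrow> v\<^sub>m) at_bot" "(V \<longlongrightarrow> v\<^sub>p) at_top" "(U \<longlongrightarrow> u\<^sub>m) at_bot" "(U \<longlongrightarrow> u\<^sub>p) at_top"
    by (simp_all add: travelling_wave_def)
  have bot: "at_bot \<noteq> (bot :: real filter)" and top: "at_top \<noteq> (bot :: real filter)"
    by (rule trivial_limit_at_bot_linorder, rule trivial_limit_at_top_linorder)
  \<comment> \<open>Everything is read off from the slice \<open>t = 0\<close>, where the wave
    coincides with its profile.\<close>
  obtain v\<^sub>t u\<^sub>t u\<^sub>x q d where *: "\<And>x. V x > 1"
      "\<And>x. ((\<lambda>\<tau>. V (x - s * \<tau>)) has_real_derivative v\<^sub>t x) (at 0)"
      "\<And>x. ((\<lambda>\<tau>. U (x - s * \<tau>)) has_real_derivative u\<^sub>t x) (at 0)"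
      "\<And>x. (U has_real_derivative u\<^sub>x x) (at x)"
      "\<And>x. ((\<lambda>y. ?p (V y)) has_real_derivative q x) (at x)"
      "\<And>x. ((\<lambda>y. 1 / V y * u\<^sub>x y) has_real_derivative d x) (at x)"
      "\<And>x. v\<^sub>t x - u\<^sub>x x = 0" "\<And>x. u\<^sub>t x + q x - \<mu> * d x = 0"
  proof -
    obtain v\<^sub>t u\<^sub>t u\<^sub>x q d where *: "\<forall>t x. V (x - s * t) > 1 \<and>
        ((\<lambda>\<tau>. V (x - s * \<tau>)) has_real_derivative v\<^sub>t t x) (at t) \<and>
        ((\<lambda>\<tau>. U (x - s * \<tau>)) has_real_derivative u\<^sub>t t x) (at t) \<and>
        ((\<lambda>y. U (y - s * t)) has_real_derivative u\<^sub>x t x) (at x) \<and>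
        ((\<lambda>y. ?p (V (y - s * t))) has_real_derivative q t x) (at x) \<and>
        ((\<lambda>y. 1 / V (y - s * t) * u\<^sub>x t y) has_real_derivative d t x) (at x) \<and>
        v\<^sub>t t x - u\<^sub>x t x = 0 \<and> u\<^sub>t t x + q t x - \<mu> * d t x = 0"
      using cs unfolding classical_solution_def travelling_wave_def by blast
    show thesis
      by (rule that[of "v\<^sub>t 0" "u\<^sub>t 0" "u\<^sub>x 0" "q 0" "d 0"]) (use *[THEN spec, of 0, unfolded mult_zero_right diff_zero] in blast)+
  qed
  \<comment> \<open>A standing wave has \<open>v_t = 0\<close>, hence \<open>u_x = 0\<close> and
    constant velocity, against \<open>u\<^sub>p < u\<^sub>m\<close>.\<close>
  have s0: "s \<noteq> 0"
  proof
    assume "s = 0"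
    then have "v\<^sub>t x = 0" for x
      using *(2)[of x] DERIV_unique[OF _ DERIV_const] by fastforce
    then have "(U has_real_derivative 0) (at x)" for x
      using *(4)[of x] *(7)[of x] by simp
    then have "U x = U 0" for x
      by (rule DERIV_isconst_all[rule_format])
    then have "U = (\<lambda>_. U 0)" by blast
    then have "u\<^sub>m = U 0" "u\<^sub>p = U 0"
      using lim(3,4) by (metis bot tendsto_const tendsto_unique, metis top tendsto_const tendsto_unique)
    then show False using u by simp
  qed
  have dV: "(V has_real_derivative - u\<^sub>x x / s) (at x)" for x
  proof -
    \<comment> \<open>The definition of a solution supplies a time derivative of \<open>v\<close>
      but no space derivative. With \<open>s \<noteq> 0\<close>, the substitution
      \<open>\<tau> = (x - y) / s\<close> turns the former, at time 0, into the latter.\<close>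
    have "((\<lambda>y. V (x - s * ((x - y) / s))) has_real_derivative v\<^sub>t x * (- 1 / s)) (at x)"
      by (rule DERIV_chain2[where f = "\<lambda>\<tau>. V (x - s * \<tau>)"])
         (use *(2)[of x] s0 in \<open>auto intro!: derivative_eq_intros\<close>)
    then show ?thesis using s0 *(7)[of x] by simp
  qed
  have u\<^sub>t: "u\<^sub>t x = - s * u\<^sub>x x" for x
  proof -
    have "((\<lambda>\<tau>. U (x - s * \<tau>)) has_real_derivative u\<^sub>x x * - s) (at 0)"
      by (rule DERIV_chain2[where f = U]) (use *(4)[of x] in \<open>auto intro!: derivative_eq_intros\<close>)
    then show ?thesis using DERIV_unique *(3)[of x] by fastforce
  qed
  have "((\<lambda>y. U y + s * V y) has_real_derivative u\<^sub>x x + s * (- u\<^sub>x x / s)) (at x)" for x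
    by (intro DERIV_add DERIV_cmult dV *(4))
  then have "((\<lambda>y. U y + s * V y) has_real_derivative 0) (at x)" for x
    using s0 by simp
  then have mass: "U x + s * V x = U 0 + s * V 0" for x
    by (rule DERIV_isconst_all[rule_format])
  have mass_const: "(\<lambda>x. U x + s * V x) = (\<lambda>_. U 0 + s * V 0)"
    by (rule ext) (rule mass)
  have "((\<lambda>x. U x + s * V x) \<longlongrightarrow> u\<^sub>m + s * v\<^sub>m) at_bot" "((\<lambda>x. U x + s * V x) \<longlongrightarrow> u\<^sub>p + s * v\<^sub>p) at_top"
    by (intro tendsto_intros lim)+
  then have ends: "U 0 + s * V 0 = u\<^sub>m + s * v\<^sub>m" "U 0 + s * V 0 = u\<^sub>p + s * v\<^sub>p"
    unfolding mass_const using bot top by (simp_all add: tendsto_const_iff)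
  then show speed: "s = (u\<^sub>m - u\<^sub>p) / (v\<^sub>p - v\<^sub>m)"
    using vmp by (simp add: field_simps)
  have Ux: "U x = u\<^sub>m - s * (V x - v\<^sub>m)" for x
    using mass[of x] ends by (simp add: algebra_simps)
  show "U \<xi> = u\<^sub>m - s * (V \<xi> - v\<^sub>m)"
    by (rule Ux)
  \<comment> \<open>Squaring the speed relation and inserting the jump condition on the velocities
    gives Rankine-Hugoniot after cancelling one factor \<open>v\<^sub>p - v\<^sub>m\<close>.\<close>
  have "s\<^sup>2 * (v\<^sub>p - v\<^sub>m)\<^sup>2 = (?p v\<^sub>m - ?p v\<^sub>p) * (v\<^sub>p - v\<^sub>m)"
  proof -
    have "s * (v\<^sub>p - v\<^sub>m) = u\<^sub>m - u\<^sub>p"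
      using ends by (simp add: algebra_simps)
    then have "s\<^sup>2 * (v\<^sub>p - v\<^sub>m)\<^sup>2 = (u\<^sub>p - u\<^sub>m)\<^sup>2"
      by (metis power_mult_distrib power2_commute)
    then show ?thesis
      using jump by (simp add: algebra_simps)
  qed
  then have "s\<^sup>2 * (v\<^sub>p - v\<^sub>m) = ?p v\<^sub>m - ?p v\<^sub>p"
    using vmp by (simp add: power2_eq_square)
  moreover have "s > 0" using speed u vmp by simp
  ultimately show vs: "viscous_shock \<mu> \<gamma> \<epsilon> v\<^sub>m v\<^sub>p s"
    using mu gamma eps vm vmp by unfold_locales auto
  interpret viscous_shock \<mu> \<gamma> \<epsilon> v\<^sub>m v\<^sub>p s by (rule vs)
  \<comment> \<open>The momentum flux in the frame of the wave, constant by the momentum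
    equation.\<close>
  define M where "M x = - s * U x + ?p (V x) - \<mu> * (1 / V x * u\<^sub>x x)" for x
  have "(M has_real_derivative - s * u\<^sub>x x + q x - \<mu> * d x) (at x)" for x
    unfolding M_def by (intro DERIV_diff DERIV_add DERIV_cmult *)
  moreover have "- s * u\<^sub>x x + q x - \<mu> * d x = 0" for x
    using *(8)[of x] u\<^sub>t[of x] by simp
  ultimately have "(M has_real_derivative 0) (at x)" for x
    by metis
  then have mom: "M x = M 0" for x
    by (rule DERIV_isconst_all[rule_format])
  \<comment> \<open>\<open>K\<close> is the deviation of the flux from its value at the left state
    at rest, \<open>- s * u\<^sub>m + p(v\<^sub>m)\<close>. It perturbs the profile equation by
    \<open>V x / (\<mu> * s) * K\<close>; the limit at \<open>-\<infinity>\<close> forces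
    \<open>K = 0\<close>.\<close>
  define K where "K = M 0 + s * u\<^sub>m - ?p v\<^sub>m"
  have ode: "- u\<^sub>x x / s = profile_field (V x) + V x / (\<mu> * s) * K" for x
  proof -
    have "\<mu> * u\<^sub>x x = V x * (- s * U x + ?p (V x) - M 0)"
      using mom[of x] *(1)[of x] by (simp add: M_def field_simps)
    also have "\<dots> = - V x * (chord_gap (V x) + K)"
      unfolding chord_gap_def K_def Ux by (simp add: algebra_simps power2_eq_square)
    finally have "\<mu> * u\<^sub>x x = - V x * (chord_gap (V x) + K)" .
    then have "u\<^sub>x x = - V x * (chord_gap (V x) + K) / \<mu>"
      using mu by (simp add: field_simps)
    then show ?thesis
      using mu s by (simp add: profile_field_def field_simps)
  qed
  have "isCont profile_field v\<^sub>m"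
    using vm profile_field_differentiable DERIV_isCont by metis
  then have "((\<lambda>x. profile_field (V x) + V x / (\<mu> * s) * K) \<longlongrightarrow> profile_field v\<^sub>m + v\<^sub>m / (\<mu> * s) * K) at_bot"
    using mu s by (intro tendsto_intros lim isCont_tendsto_compose[of _ profile_field]) auto
  then have "((\<lambda>x. - u\<^sub>x x / s) \<longlongrightarrow> profile_field v\<^sub>m + v\<^sub>m / (\<mu> * s) * K) at_bot"
    by (simp only: ode)
  then have "profile_field v\<^sub>m + v\<^sub>m / (\<mu> * s) * K = 0"
    by (rule tendsto_deriv_at_bot_eq_0[OF dV lim(1)])
  then have "K = 0" using vm mu s by (simp add: profile_field_ends)
  then have dV': "(V has_real_derivative profile_field (V x)) (at x)" for x
    using dV[of x] ode[of x] by simp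
  show "(V has_real_derivative profile_field (V \<xi>)) (at \<xi>)"
    by (rule dV')
  show "V \<xi> \<in> {v\<^sub>m<..<v\<^sub>p}"
    by (rule profile_range[OF *(1) dV' lim(1,2)])
qed

section \<open>Travelling waves in the sense of distributions\<close>

text \<open>The fundamental theorem of calculus tolerates the finite set \<open>S\<close>, which
  will hold the corner of the congested profile, and the boundary terms lie outside the
  support.\<close>

lemma integral_derivative_compact_support:
  fixes f f' :: "real \<Rightarrow> real"
  assumes "finite S" "continuous_on UNIV f"
    and deriv: "\<And>x. x \<notin> S \<Longrightarrow> (f has_real_derivative f' x) (at x)"
    and supp: "\<And>x. \<bar>x\<bar> > R \<Longrightarrow> f x = 0 \<and> f' x = 0"
  shows "(LINT x|lborel. f' x) = 0"
\<comment> \<open>For a non-integrable \<open>f'\<close> the Bochner integral has the default value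
  0, which is the claim.\<close>
proof (cases "integrable lborel f'")
  case True
  \<comment> \<open>The absolute value puts both ends strictly outside the support even for a
    negative \<open>R\<close>.\<close>
  define b where "b = \<bar>R\<bar> + 1"
  have b: "- b \<le> b" "\<bar>b\<bar> > R" "\<bar>- b\<bar> > R" by (auto simp: b_def)
  have "(f' has_integral (f b - f (- b))) {- b..b}"
  proof (rule fundamental_theorem_of_calculus_interior_strong[OF assms(1) b(1)])
    show "(f has_vector_derivative f' x) (at x)" if "x \<in> {- b<..<b} - S" for x
      using deriv that by (simp add: has_real_derivative_iff_has_vector_derivative)
    show "continuous_on {- b..b} f"
      using assms(2) continuous_on_subset by blast
  qed
  then have "(f' has_integral 0) {- b..b}"
    using supp[OF b(2)] supp[OF b(3)] by simp
  then have "(f' has_integral 0) UNIV"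
    by (rule has_integral_on_superset) (auto simp: b_def intro!: supp[THEN conjunct2])
  then show ?thesis
    using integral_lborel[OF True] by (simp add: integral_unique)
qed (simp add: not_integrable_integral_eq)

lemma integrable_bounded_mult_compact_support:
  fixes G \<psi> :: "'a::euclidean_space \<Rightarrow> real"
  assumes G: "G \<in> borel_measurable borel" "\<And>z. \<bar>G z\<bar> \<le> M"
    and \<psi>: "continuous_on UNIV \<psi>" "compact K" "\<And>z. z \<notin> K \<Longrightarrow> \<psi> z = 0"
  shows "integrable lborel (\<lambda>z. G z * \<psi> z)"
proof -
  have eq: "(\<lambda>z. indicator K z *\<^sub>R \<psi> z) = \<psi>"
    using \<psi>(3) by (force simp: indicator_def)
  have "integrable lborel (\<lambda>z. indicator K z *\<^sub>R \<psi> z)"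
    using \<psi> by (intro borel_integrable_compact) (auto intro: continuous_on_subset)
  then have int: "integrable lborel \<psi>"
    unfolding eq .
  have [measurable]: "\<psi> \<in> borel_measurable borel"
    using \<psi>(1) by (rule borel_measurable_continuous_onI)
  note G(1)[measurable]
  show ?thesis
  proof (rule Bochner_Integration.integrable_bound)
    show "integrable lborel (\<lambda>z. M * \<psi> z)" using int by simp
    have "\<bar>G z\<bar> * \<bar>\<psi> z\<bar> \<le> \<bar>M\<bar> * \<bar>\<psi> z\<bar>" for z
      using G(2)[of z] by (intro mult_right_mono) auto
    then show "AE z in lborel. norm (G z * \<psi> z) \<le> norm (M * \<psi> z)"
      by (simp add: abs_mult)
  qed measurable
qed

lemma integral_lborel_pair:
  fixes f :: "real \<times> real \<Rightarrow> real"
  assumes "integrable lborel f"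
  shows "integral\<^sup>L lborel f = (LINT t|lborel. LINT x|lborel. f (t, x))"
  using lborel_pair.integral_fst'[of f] assms by (simp add: lborel_prod)

section \<open>Bounded travelling waves against test functions\<close>

lemma travelling_wave_measurable:
  assumes "F \<in> borel_measurable borel"
  shows "(\<lambda>(t, x). travelling_wave \<sigma> F t x) \<in> borel_measurable borel"
proof -
  have "(\<lambda>z. snd z - \<sigma> * fst z :: real) \<in> borel_measurable borel"
    by (intro borel_measurable_continuous_onI continuous_intros)
  then show ?thesis
    using measurable_compose[OF _ assms] by (simp add: travelling_wave_def case_prod_beta')
qed

lemma integrable_travelling_wave_mult:
  fixes F :: "real \<Rightarrow> real"
  assumes "F \<in> borel_measurable borel" "\<And>\<xi>. \<bar>F \<xi>\<bar> \<le> M"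
    and "continuous_on UNIV \<psi>" "compact K" "\<And>z. z \<notin> K \<Longrightarrow> \<psi> z = 0"
  shows "integrable lborel (\<lambda>(t, x). travelling_wave \<sigma> F t x * \<psi> (t, x))"
proof -
  have "integrable lborel (\<lambda>z. (case z of (t, x) \<Rightarrow> travelling_wave \<sigma> F t x) * \<psi> z)"
    by (rule integrable_bounded_mult_compact_support[OF travelling_wave_measurable[OF assms(1)] _ assms(3-5)])
       (auto simp: travelling_wave_def intro: assms(2))
  then show ?thesis
    by (simp add: case_prod_beta')
qed

lemma locally_integrable_travelling_wave:
  assumes F: "F \<in> borel_measurable borel" "\<And>\<xi>. \<bar>F \<xi>\<bar> \<le> M"
  shows "locally_integrable (travelling_wave \<sigma> F)"
  unfolding locally_integrable_def set_integrable_def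
proof (intro allI impI)
  fix K :: "(real \<times> real) set" assume K: "compact K"
  note [measurable] = travelling_wave_measurable[OF F(1)]
  have [measurable]: "K \<in> sets borel" using K by (simp add: borel_compact)
  have "integrable lborel (\<lambda>z. indicator K z *\<^sub>R M)"
    by (intro borel_integrable_compact K continuous_intros)
  then show "integrable lborel (\<lambda>z. indicator K z *\<^sub>R (case z of (t, x) \<Rightarrow> travelling_wave \<sigma> F t x))"
  proof (rule Bochner_Integration.integrable_bound)
    show "AE z in lborel. norm (indicator K z *\<^sub>R (case z of (t, x) \<Rightarrow> travelling_wave \<sigma> F t x))
      \<le> norm (indicator K z *\<^sub>R M)"
      using order_trans[OF F(2) abs_ge_self]
      by (auto simp: travelling_wave_def case_prod_beta' indicator_def)
  qed measurable
qed

text \<open>Off the closed support \<open>\<phi>\<close> vanishes in a neighbourhood, so its total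
  derivative is 0 there; evaluating it at the two coordinate vectors kills both partial derivatives.
  One compact set thus serves for all three functions.\<close>

lemma test_function_support:
  assumes "test_function \<phi> \<phi>\<^sub>t \<phi>\<^sub>x"
  obtains K where "compact K" "\<And>z. z \<notin> K \<Longrightarrow> \<phi> z = 0 \<and> \<phi>\<^sub>t z = 0 \<and> \<phi>\<^sub>x z = 0"
proof -
  define K where "K = closure {z. \<phi> z \<noteq> 0}"
  have K: "compact K"
    using assms by (simp add: K_def test_function_def)
  have zero: "\<phi> y = 0" if "y \<notin> K" for y
    using that closure_subset[of "{z. \<phi> z \<noteq> 0}"] unfolding K_def by blast
  have "\<phi> z = 0 \<and> \<phi>\<^sub>t z = 0 \<and> \<phi>\<^sub>x z = 0" if z: "z \<notin> K" for z
  proof -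
    have "(\<phi> has_derivative (\<lambda>h. 0)) (at z)"
      by (rule has_derivative_transform_within_open[OF has_derivative_const, of "- K" z 0])
         (use z zero K in \<open>auto simp: compact_imp_closed\<close>)
    moreover have "(\<phi> has_derivative (\<lambda>h. \<phi>\<^sub>t z * fst h + \<phi>\<^sub>x z * snd h)) (at z)"
      using assms unfolding test_function_def by blast
    ultimately have "(\<lambda>h. \<phi>\<^sub>t z * fst h + \<phi>\<^sub>x z * snd h) = (\<lambda>h. 0)"
      by (rule has_derivative_unique[symmetric])
    then have "\<phi>\<^sub>t z * fst h + \<phi>\<^sub>x z * snd h = 0" for h
      by (rule fun_cong)
    from this[of "(1, 0)"] this[of "(0, 1)"] zero[of z] z
    show ?thesis by simp
  qed
  then show thesis
    using that K by blast
qed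

lemma test_function_along_line:
  assumes "test_function \<phi> \<phi>\<^sub>t \<phi>\<^sub>x"
    and "(\<alpha> has_real_derivative \<alpha>') (at y)" "(\<beta> has_real_derivative \<beta>') (at y)"
  shows "((\<lambda>y. \<phi> (\<alpha> y, \<beta> y)) has_real_derivative
    \<phi>\<^sub>t (\<alpha> y, \<beta> y) * \<alpha>' + \<phi>\<^sub>x (\<alpha> y, \<beta> y) * \<beta>') (at y)"
proof -
  have "((\<lambda>y. (\<alpha> y, \<beta> y)) has_derivative (\<lambda>h. (\<alpha>' * h, \<beta>' * h))) (at y)"
    using assms(2,3) by (auto intro!: has_derivative_Pair simp: has_field_derivative_def mult_commute_abs)
  moreover have "(\<phi> has_derivative (\<lambda>h. \<phi>\<^sub>t (\<alpha> y, \<beta> y) * fst h + \<phi>\<^sub>x (\<alpha> y, \<beta> y) * snd h)) (at (\<alpha> y, \<beta> y))"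
    using assms(1) by (simp add: test_function_def)
  ultimately have "((\<lambda>y. \<phi> (\<alpha> y, \<beta> y)) has_derivative
      (\<lambda>h. \<phi>\<^sub>t (\<alpha> y, \<beta> y) * fst (\<alpha>' * h, \<beta>' * h) + \<phi>\<^sub>x (\<alpha> y, \<beta> y) * snd (\<alpha>' * h, \<beta>' * h))) (at y)"
    by (rule has_derivative_compose)
  moreover have "(\<lambda>h. \<phi>\<^sub>t (\<alpha> y, \<beta> y) * fst (\<alpha>' * h, \<beta>' * h) + \<phi>\<^sub>x (\<alpha> y, \<beta> y) * snd (\<alpha>' * h, \<beta>' * h))
      = (*) (\<phi>\<^sub>t (\<alpha> y, \<beta> y) * \<alpha>' + \<phi>\<^sub>x (\<alpha> y, \<beta> y) * \<beta>')"
    by (auto simp: algebra_simps)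
  ultimately show ?thesis
    by (simp add: has_field_derivative_def)
qed

lemma test_function_continuous:
  assumes "test_function \<phi> \<phi>\<^sub>t \<phi>\<^sub>x"
  shows "continuous_on UNIV \<phi>" "continuous_on UNIV \<phi>\<^sub>t" "continuous_on UNIV \<phi>\<^sub>x"
  using assms by (auto simp: test_function_def intro!: continuous_at_imp_continuous_on
      intro: has_derivative_continuous)

text \<open>Integration by parts on each line of constant \<open>t\<close>: the sum of the two
  integrands is the \<open>x\<close>-derivative of
  \<open>f (x - \<sigma> * t) * \<phi> (t, x)\<close>. Fubini then integrates over
  \<open>t\<close>.\<close>

lemma travelling_wave_parts:
  assumes test: "test_function \<phi> \<phi>\<^sub>t \<phi>\<^sub>x" and "finite S"
    and f: "continuous_on UNIV f" "\<And>\<xi>. \<bar>f \<xi>\<bar> \<le> M"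
    and f': "f' \<in> borel_measurable borel" "\<And>\<xi>. \<bar>f' \<xi>\<bar> \<le> M'"
    and deriv: "\<And>\<xi>. \<xi> \<notin> S \<Longrightarrow> (f has_real_derivative f' \<xi>) (at \<xi>)"
  shows "(LINT (t, x)|lborel. travelling_wave \<sigma> f t x * \<phi>\<^sub>x (t, x))
       = - (LINT (t, x)|lborel. travelling_wave \<sigma> f' t x * \<phi> (t, x))"
proof -
  obtain K where K: "compact K" "\<And>z. z \<notin> K \<Longrightarrow> \<phi> z = 0 \<and> \<phi>\<^sub>t z = 0 \<and> \<phi>\<^sub>x z = 0"
    using test_function_support[OF test] by blast
  note cont = test_function_continuous[OF test]
  obtain R where R: "\<And>z. z \<in> K \<Longrightarrow> norm z \<le> R"
    using compact_imp_bounded[OF K(1)] unfolding bounded_iff by blast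
  have supp: "\<phi> (t, x) = 0 \<and> \<phi>\<^sub>x (t, x) = 0" if "\<bar>x\<bar> > R" for t x
    using K(2)[of "(t, x)"] R[of "(t, x)"] that norm_snd_le[of x t] by fastforce
  have int1: "integrable lborel (\<lambda>(t, x). travelling_wave \<sigma> f t x * \<phi>\<^sub>x (t, x))"
    by (rule integrable_travelling_wave_mult[OF borel_measurable_continuous_onI[OF f(1)] f(2) cont(3) K(1)])
       (use K(2) in simp)
  have int2: "integrable lborel (\<lambda>(t, x). travelling_wave \<sigma> f' t x * \<phi> (t, x))"
    by (rule integrable_travelling_wave_mult[OF f' cont(1) K(1)]) (use K(2) in simp)
  have slice: "(LINT x|lborel. f (x - \<sigma> * t) * \<phi>\<^sub>x (t, x) + f' (x - \<sigma> * t) * \<phi> (t, x)) = 0" for t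
  \<comment> \<open>The exceptional points travel with the wave, so at time \<open>t\<close> they
    are those of \<open>S\<close> moved by \<open>\<sigma> * t\<close>.\<close>
  proof (rule integral_derivative_compact_support[where f = "\<lambda>x. f (x - \<sigma> * t) * \<phi> (t, x)"
        and S = "(\<lambda>\<xi>. \<xi> + \<sigma> * t) ` S" and R = R])
    show "continuous_on UNIV (\<lambda>x. f (x - \<sigma> * t) * \<phi> (t, x))"
      by (intro continuous_intros continuous_on_compose2[OF f(1)] continuous_on_compose2[OF cont(1)]) auto
    fix x assume "x \<notin> (\<lambda>\<xi>. \<xi> + \<sigma> * t) ` S"
    then have x: "x - \<sigma> * t \<notin> S" by (auto simp: image_iff algebra_simps)
    have "((\<lambda>x. f (x - \<sigma> * t)) has_real_derivative f' (x - \<sigma> * t) * 1) (at x)"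
      by (rule DERIV_chain2[where f = f and g = "\<lambda>x. x - \<sigma> * t", OF deriv[OF x]])
         (auto intro!: derivative_eq_intros)
    moreover have "((\<lambda>x. \<phi> (t, x)) has_real_derivative \<phi>\<^sub>t (t, x) * 0 + \<phi>\<^sub>x (t, x) * 1) (at x)"
      by (rule test_function_along_line[OF test]) (auto intro!: derivative_eq_intros)
    ultimately show "((\<lambda>x. f (x - \<sigma> * t) * \<phi> (t, x)) has_real_derivative
        f (x - \<sigma> * t) * \<phi>\<^sub>x (t, x) + f' (x - \<sigma> * t) * \<phi> (t, x)) (at x)"
      by (auto intro!: derivative_eq_intros)
  qed (use supp \<open>finite S\<close> in auto)
  have "(LINT (t, x)|lborel. travelling_wave \<sigma> f t x * \<phi>\<^sub>x (t, x))
      + (LINT (t, x)|lborel. travelling_wave \<sigma> f' t x * \<phi> (t, x))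
      = (LINT z|lborel. (case z of (t, x) \<Rightarrow> travelling_wave \<sigma> f t x * \<phi>\<^sub>x (t, x))
           + (case z of (t, x) \<Rightarrow> travelling_wave \<sigma> f' t x * \<phi> (t, x)))"
    using int1 int2 by simp
  also have "\<dots> = 0"
    by (subst integral_lborel_pair) (use int1 int2 slice in \<open>auto simp: travelling_wave_def\<close>)
  finally show ?thesis by simp
qed

text \<open>In the coordinates \<open>t\<close> and \<open>\<xi> = x - \<sigma> * t\<close> the wave
  no longer depends on \<open>t\<close>, while
  \<open>\<phi>\<^sub>t + \<sigma> * \<phi>\<^sub>x\<close> is the derivative of
  \<open>\<phi>\<close> along the line of fixed \<open>\<xi>\<close>. Integrating over
  \<open>t\<close> first gives 0.\<close>

lemma travelling_wave_transport:
  assumes test: "test_function \<phi> \<phi>\<^sub>t \<phi>\<^sub>x"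
    and F: "F \<in> borel_measurable borel" "\<And>\<xi>. \<bar>F \<xi>\<bar> \<le> M"
  shows "(LINT (t, x)|lborel. travelling_wave \<sigma> F t x * (\<phi>\<^sub>t (t, x) + \<sigma> * \<phi>\<^sub>x (t, x))) = 0"
proof -
  let ?\<psi> = "\<lambda>z. \<phi>\<^sub>t z + \<sigma> * \<phi>\<^sub>x z"
  obtain K where K: "compact K" "\<And>z. z \<notin> K \<Longrightarrow> \<phi> z = 0 \<and> \<phi>\<^sub>t z = 0 \<and> \<phi>\<^sub>x z = 0"
    using test_function_support[OF test] by blast
  note cont = test_function_continuous[OF test]
  obtain R where R: "\<And>z. z \<in> K \<Longrightarrow> norm z \<le> R"
    using compact_imp_bounded[OF K(1)] unfolding bounded_iff by blast
  have supp: "\<phi> (t, x) = 0 \<and> \<phi>\<^sub>t (t, x) = 0 \<and> \<phi>\<^sub>x (t, x) = 0" if "\<bar>t\<bar> > R" for t x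
    using K(2)[of "(t, x)"] R[of "(t, x)"] that norm_fst_le[of t x] by fastforce
  have cont_\<psi>: "continuous_on UNIV ?\<psi>"
    using cont by (intro continuous_intros)
  have int1: "integrable lborel (\<lambda>(t, x). travelling_wave \<sigma> F t x * ?\<psi> (t, x))"
    by (rule integrable_travelling_wave_mult[OF F cont_\<psi> K(1)]) (use K(2) in simp)
  \<comment> \<open>Exchanging the order of integration needs integrability in the sheared
    coordinates; the support there is the compact image of \<open>K\<close> under the inverse
    shear.\<close>
  have int2: "integrable lborel (\<lambda>(t, \<xi>). F \<xi> * ?\<psi> (t, \<xi> + \<sigma> * t))"
  proof -
    let ?sh = "\<lambda>z :: real \<times> real. (fst z, snd z + \<sigma> * fst z)"
    let ?K = "(\<lambda>z. (fst z, snd z - \<sigma> * fst z)) ` K"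
    have "integrable lborel (\<lambda>z. F (snd z) * ?\<psi> (?sh z))"
    proof (rule integrable_bounded_mult_compact_support[where K = ?K and M = M])
      have "snd \<in> borel_measurable (borel :: (real \<times> real) measure)"
        by (intro borel_measurable_continuous_onI continuous_intros)
      then show "(\<lambda>z::real \<times> real. F (snd z)) \<in> borel_measurable borel"
        using measurable_compose[OF _ F(1)] by blast
      show "continuous_on UNIV (\<lambda>z. ?\<psi> (?sh z))"
        by (intro continuous_on_compose2[OF cont_\<psi>] continuous_intros) auto
      show "compact ?K"
        by (intro compact_continuous_image K continuous_intros)
      show "?\<psi> (?sh z) = 0" if "z \<notin> ?K" for z
      proof -
        have "?sh z \<notin> K"
        proof
          assume "?sh z \<in> K"
          then have "(fst (?sh z), snd (?sh z) - \<sigma> * fst (?sh z)) \<in> ?K" by (rule imageI)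
          then show False using that by simp
        qed
        then show ?thesis using K(2) by simp
      qed
    qed (use F(2) in auto)
    then show ?thesis by (simp add: case_prod_beta')
  qed
  have "(LINT (t, x)|lborel. travelling_wave \<sigma> F t x * ?\<psi> (t, x))
      = (LINT t|lborel. LINT x|lborel. F (x - \<sigma> * t) * ?\<psi> (t, x))"
    using integral_lborel_pair[OF int1] by (simp add: travelling_wave_def)
  also have "\<dots> = (LINT t|lborel. LINT \<xi>|lborel. F \<xi> * ?\<psi> (t, \<xi> + \<sigma> * t))"
  proof -
    have "(LINT x|lborel. F (x - \<sigma> * t) * ?\<psi> (t, x)) = (LINT \<xi>|lborel. F \<xi> * ?\<psi> (t, \<xi> + \<sigma> * t))" for t
      using lborel_integral_real_affine[of 1 "\<lambda>x. F (x - \<sigma> * t) * ?\<psi> (t, x)" "\<sigma> * t"]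
      by (simp add: add.commute)
    then show ?thesis by simp
  qed
  also have "\<dots> = (LINT \<xi>|lborel. LINT t|lborel. F \<xi> * ?\<psi> (t, \<xi> + \<sigma> * t))"
    using lborel_pair.Fubini_integral[of "\<lambda>t \<xi>. F \<xi> * ?\<psi> (t, \<xi> + \<sigma> * t)"] int2
    by (simp add: lborel_prod)
  also have "\<dots> = (LINT \<xi>|lborel. F \<xi> * (LINT t|lborel. ?\<psi> (t, \<xi> + \<sigma> * t)))"
    by simp
  also have "\<dots> = 0"
  proof -
    have "(LINT t|lborel. ?\<psi> (t, \<xi> + \<sigma> * t)) = 0" for \<xi>
    proof (rule integral_derivative_compact_support[where f = "\<lambda>t. \<phi> (t, \<xi> + \<sigma> * t)" and S = "{}" and R = R])
      show "continuous_on UNIV (\<lambda>t. \<phi> (t, \<xi> + \<sigma> * t))"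
        by (intro continuous_on_compose2[OF cont(1)] continuous_intros) auto
      fix t
      have "((\<lambda>t. \<phi> (t, \<xi> + \<sigma> * t)) has_real_derivative
          \<phi>\<^sub>t (t, \<xi> + \<sigma> * t) * 1 + \<phi>\<^sub>x (t, \<xi> + \<sigma> * t) * \<sigma>) (at t)"
        by (rule test_function_along_line[OF test]) (auto intro!: derivative_eq_intros)
      then show "((\<lambda>t. \<phi> (t, \<xi> + \<sigma> * t)) has_real_derivative ?\<psi> (t, \<xi> + \<sigma> * t)) (at t)"
        by (simp add: mult.commute)
    qed (use supp in auto)
    then show ?thesis by simp
  qed
  finally show ?thesis .
qed

section \<open>The partially congested profile\<close>

text \<open>At \<open>\<xi> = 0\<close> the exponential formula equals 1, so freezing its argument
  at 0 reproduces the congested branch. The single expression gives the bounds and continuity across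
  the interface at once.\<close>

lemma vbar_eq:
  assumes "v\<^sub>p > 1"
  shows "vbar \<mu> v\<^sub>p \<xi> = v\<^sub>p / (1 + (v\<^sub>p - 1) * exp (- (v\<^sub>p / (\<mu> * sqrt (v\<^sub>p - 1))) * max \<xi> 0))"
  using assms by (auto simp: vbar_def Let_def max_def)

context
  fixes \<mu> v\<^sub>p :: real
  assumes mu: "\<mu> > 0" and vp: "v\<^sub>p > 1"
begin

lemma vbar_bounds: "1 \<le> vbar \<mu> v\<^sub>p \<xi>" "vbar \<mu> v\<^sub>p \<xi> < v\<^sub>p"
proof -
  define e where "e = exp (- (v\<^sub>p / (\<mu> * sqrt (v\<^sub>p - 1))) * max \<xi> 0)"
  have e: "0 < e" "e \<le> 1"
    using mu vp by (auto simp: e_def)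
  define X where "X = (v\<^sub>p - 1) * e"
  have "X \<le> v\<^sub>p - 1" "X > 0"
    unfolding X_def using e vp by (auto intro: mult_left_le)
  then show "1 \<le> vbar \<mu> v\<^sub>p \<xi>" "vbar \<mu> v\<^sub>p \<xi> < v\<^sub>p"
    unfolding vbar_eq[OF vp] e_def[symmetric] X_def[symmetric] using vp
    by (auto simp: le_divide_eq divide_less_eq)
qed

lemma continuous_on_vbar: "continuous_on A (vbar \<mu> v\<^sub>p)"
proof -
  have "1 + (v\<^sub>p - 1) * exp (- (v\<^sub>p / (\<mu> * sqrt (v\<^sub>p - 1))) * max \<xi> 0) \<noteq> 0" for \<xi>
    using vp by (smt (verit) exp_gt_zero mult_pos_pos)
  then show ?thesis
    unfolding vbar_eq[OF vp, abs_def] by (intro continuous_intros) auto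
qed

lemma vbar_at_bot: "(vbar \<mu> v\<^sub>p \<longlongrightarrow> 1) at_bot"
  by (rule tendsto_eventually) (auto simp: eventually_at_bot_dense vbar_def)

lemma vbar_at_top: "(vbar \<mu> v\<^sub>p \<longlongrightarrow> v\<^sub>p) at_top"
proof -
  let ?r = "v\<^sub>p / (\<mu> * sqrt (v\<^sub>p - 1))"
  have r: "?r > 0" using mu vp by simp
  have "filterlim (\<lambda>\<xi>. - ?r * \<xi>) at_bot at_top"
    using r by (intro filterlim_tendsto_neg_mult_at_bot[OF tendsto_const _ filterlim_ident]) simp
  then have "((\<lambda>\<xi>. exp (- ?r * \<xi>)) \<longlongrightarrow> 0) at_top"
    using filterlim_compose[OF exp_at_bot] by blast
  then have "((\<lambda>\<xi>. v\<^sub>p / (1 + (v\<^sub>p - 1) * exp (- ?r * \<xi>))) \<longlongrightarrow> v\<^sub>p / (1 + (v\<^sub>p - 1) * 0)) at_top"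
    by (intro tendsto_intros) auto
  moreover have "\<forall>\<^sub>F \<xi> in at_top. v\<^sub>p / (1 + (v\<^sub>p - 1) * exp (- ?r * \<xi>)) = vbar \<mu> v\<^sub>p \<xi>"
    using eventually_ge_at_top[of 0] by eventually_elim (simp add: vbar_def)
  ultimately show ?thesis
    by (simp add: tendsto_cong)
qed

text \<open>The value at \<open>0\<close> is the right derivative, which makes the flux identity below hold at every point.\<close>

definition vbar_deriv :: "real \<Rightarrow> real" where
  "vbar_deriv \<xi> = (if \<xi> < 0 then 0
     else v\<^sub>p / (\<mu> * sqrt (v\<^sub>p - 1)) * vbar \<mu> v\<^sub>p \<xi> * (1 - vbar \<mu> v\<^sub>p \<xi> / v\<^sub>p))"

text \<open>In the free region the profile is a logistic curve, with capacity
  \<open>v\<^sub>p\<close>; \<open>vbar_deriv\<close> is the right-hand side of the logistic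
  equation.\<close>

lemma vbar_has_derivative:
  assumes "\<xi> \<noteq> 0"
  shows "(vbar \<mu> v\<^sub>p has_real_derivative vbar_deriv \<xi>) (at \<xi>)"
proof (cases "\<xi> < 0")
  case True
  have "((\<lambda>_. 1) has_real_derivative vbar_deriv \<xi>) (at \<xi>)"
    using True by (simp add: vbar_deriv_def)
  then show ?thesis
    by (rule has_field_derivative_transform_within_open[of _ _ _ "{..<0}"])
       (use True in \<open>auto simp: vbar_def\<close>)
next
  case False
  define r where "r = v\<^sub>p / (\<mu> * sqrt (v\<^sub>p - 1))"
  let ?f = "\<lambda>\<xi>. v\<^sub>p / (1 + (v\<^sub>p - 1) * exp (- r * \<xi>))"
  have pos: "1 + (v\<^sub>p - 1) * exp (- r * \<xi>) > 0"
    using vp by (smt (verit) exp_gt_zero mult_pos_pos)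
  define e where "e = exp (- r * \<xi>)"
  have pos_e: "1 + (v\<^sub>p - 1) * e \<noteq> 0"
    using pos by (simp add: e_def)
  have "(?f has_real_derivative v\<^sub>p * ((v\<^sub>p - 1) * e * r) / (1 + (v\<^sub>p - 1) * e)\<^sup>2) (at \<xi>)"
    using pos by (auto intro!: derivative_eq_intros simp: e_def power2_eq_square)
  moreover have "v\<^sub>p * ((v\<^sub>p - 1) * e * r) / (1 + (v\<^sub>p - 1) * e)\<^sup>2
      = r * (v\<^sub>p / (1 + (v\<^sub>p - 1) * e)) * (1 - v\<^sub>p / (1 + (v\<^sub>p - 1) * e) / v\<^sub>p)"
    using pos_e vp by (simp add: divide_simps power2_eq_square)
  moreover have "vbar \<mu> v\<^sub>p \<xi> = v\<^sub>p / (1 + (v\<^sub>p - 1) * e)"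
    using False by (simp add: vbar_def r_def e_def)
  ultimately have "(?f has_real_derivative vbar_deriv \<xi>) (at \<xi>)"
    using False by (simp add: vbar_deriv_def r_def)
  then show ?thesis
    by (rule has_field_derivative_transform_within_open[of _ _ _ "{0<..}"])
       (use False assms in \<open>auto simp: vbar_def r_def\<close>)
qed

lemma vbar_deriv_bounded: "\<bar>vbar_deriv \<xi>\<bar> \<le> v\<^sub>p / (\<mu> * sqrt (v\<^sub>p - 1)) * v\<^sub>p"
proof -
  let ?r = "v\<^sub>p / (\<mu> * sqrt (v\<^sub>p - 1))" and ?v = "vbar \<mu> v\<^sub>p \<xi>"
  have r: "?r > 0" using mu vp by simp
  have nonneg: "0 \<le> ?r * v\<^sub>p"
    using r vp by (intro mult_nonneg_nonneg) linarith+
  have v: "0 < ?v" "?v < v\<^sub>p" using vbar_bounds[of \<xi>] by auto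
  then have "0 \<le> 1 - ?v / v\<^sub>p" "1 - ?v / v\<^sub>p \<le> 1" using vp by (auto simp: field_simps)
  then have "\<bar>?r * ?v * (1 - ?v / v\<^sub>p)\<bar> \<le> ?r * v\<^sub>p * 1"
    unfolding abs_mult using r v nonneg by (intro mult_mono) auto
  then show ?thesis using nonneg by (simp add: vbar_deriv_def)
qed

lemma vbar_deriv_measurable: "vbar_deriv \<in> borel_measurable borel"
proof -
  have [measurable]: "vbar \<mu> v\<^sub>p \<in> borel_measurable borel"
    by (rule borel_measurable_continuous_onI[OF continuous_on_vbar])
  show ?thesis unfolding vbar_deriv_def by measurable
qed

section \<open>The congested wave solves the limit system\<close>

lemma congested_velocity_exists:
  assumes "(u\<^sub>m - u\<^sub>p) / (v\<^sub>p - 1) = \<sigma>"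
  shows "congested_velocity \<mu> v\<^sub>p u\<^sub>m u\<^sub>p (\<lambda>\<xi>. u\<^sub>m - \<sigma> * (vbar \<mu> v\<^sub>p \<xi> - 1))"
  unfolding congested_velocity_def assms
proof (intro conjI allI impI)
  show "continuous_on UNIV (\<lambda>\<xi>. u\<^sub>m - \<sigma> * (vbar \<mu> v\<^sub>p \<xi> - 1))"
    by (intro continuous_intros continuous_on_vbar)
  fix \<xi> :: real assume "\<xi> \<noteq> 0"
  then show "((\<lambda>\<xi>. u\<^sub>m - \<sigma> * (vbar \<mu> v\<^sub>p \<xi> - 1)) has_real_derivative
      - \<sigma> * deriv (vbar \<mu> v\<^sub>p) \<xi>) (at \<xi>)"
    using vbar_has_derivative[of \<xi>] by (auto intro!: derivative_eq_intros simp: DERIV_imp_deriv)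
next
  have "((\<lambda>\<xi>. u\<^sub>m - \<sigma> * (vbar \<mu> v\<^sub>p \<xi> - 1)) \<longlongrightarrow> u\<^sub>m - \<sigma> * (1 - 1)) at_bot"
    by (intro tendsto_intros vbar_at_bot)
  then show "((\<lambda>\<xi>. u\<^sub>m - \<sigma> * (vbar \<mu> v\<^sub>p \<xi> - 1)) \<longlongrightarrow> u\<^sub>m) at_bot" by simp
  have "((\<lambda>\<xi>. u\<^sub>m - \<sigma> * (vbar \<mu> v\<^sub>p \<xi> - 1)) \<longlongrightarrow> u\<^sub>m - \<sigma> * (v\<^sub>p - 1)) at_top"
    by (intro tendsto_intros vbar_at_top)
  moreover have "u\<^sub>m - \<sigma> * (v\<^sub>p - 1) = u\<^sub>p"
    using assms vp by (simp add: field_simps)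
  ultimately show "((\<lambda>\<xi>. u\<^sub>m - \<sigma> * (vbar \<mu> v\<^sub>p \<xi> - 1)) \<longlongrightarrow> u\<^sub>p) at_top" by simp
qed

text \<open>\<open>ubar + \<sigma> * vbar\<close> is continuous and has zero derivative off the
  interface, hence is constant; the limit at \<open>-\<infinity>\<close> identifies the constant as
  \<open>u\<^sub>m + \<sigma>\<close>.\<close>

lemma congested_velocity_unique:
  assumes "(u\<^sub>m - u\<^sub>p) / (v\<^sub>p - 1) = \<sigma>" and cv: "congested_velocity \<mu> v\<^sub>p u\<^sub>m u\<^sub>p ubar"
  shows "ubar = (\<lambda>\<xi>. u\<^sub>m - \<sigma> * (vbar \<mu> v\<^sub>p \<xi> - 1))"
proof -
  let ?d = "\<lambda>\<xi>. ubar \<xi> + \<sigma> * vbar \<mu> v\<^sub>p \<xi>"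
  from cv assms(1) have u: "continuous_on UNIV ubar"
    "\<And>\<xi>. \<xi> \<noteq> 0 \<Longrightarrow> (ubar has_real_derivative - \<sigma> * deriv (vbar \<mu> v\<^sub>p) \<xi>) (at \<xi>)" "(ubar \<longlongrightarrow> u\<^sub>m) at_bot"
    unfolding congested_velocity_def by auto
  have const: "?d \<xi> = ?d 0" for \<xi>
  proof (rule has_derivative_zero_unique_strong_connected[of UNIV "{0}" ?d 0])
    show "continuous_on UNIV ?d"
      by (intro continuous_intros u continuous_on_vbar)
    fix x :: real assume "x \<in> UNIV - {0}"
    then have "(?d has_real_derivative 0) (at x)"
      using u(2)[of x] vbar_has_derivative[of x] by (auto intro!: derivative_eq_intros simp: DERIV_imp_deriv)
    then show "(?d has_derivative (\<lambda>h. 0)) (at x within UNIV)"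
      by (simp add: has_field_derivative_def lambda_zero)
  qed auto
  have "(?d \<longlongrightarrow> u\<^sub>m + \<sigma> * 1) at_bot"
    by (intro tendsto_intros u vbar_at_bot)
  moreover have "?d = (\<lambda>_. ?d 0)" using const by blast
  ultimately have "?d 0 = u\<^sub>m + \<sigma>"
    using tendsto_unique[OF trivial_limit_at_bot_linorder _ tendsto_const[of "?d 0"]] by fastforce
  then show ?thesis
    using const by (intro ext) (simp add: algebra_simps)
qed

text \<open>The momentum flux is one affine function of the velocity on both sides. In the congested
  region the pressure is 1, because \<open>\<sigma> * \<sigma> * (v\<^sub>p - 1) = 1\<close>; in the
  free region viscosity alone contributes \<open>\<sigma> * \<sigma> * (v\<^sub>p - v)\<close>. At
  the interface, where \<open>v = 1\<close>, the two agree: the jumps of pressure and viscous stress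
  cancel.\<close>

lemma flux_identity:
  assumes \<sigma>: "\<sigma> = 1 / sqrt (v\<^sub>p - 1)" "(u\<^sub>m - u\<^sub>p) / (v\<^sub>p - 1) = \<sigma>"
  shows "pbar v\<^sub>p u\<^sub>m u\<^sub>p \<xi> - \<mu> * (1 / vbar \<mu> v\<^sub>p \<xi> * (- \<sigma> * vbar_deriv \<xi>))
    = \<sigma> * (u\<^sub>m - \<sigma> * (vbar \<mu> v\<^sub>p \<xi> - 1)) + (1 - \<sigma> * u\<^sub>m)"
proof -
  have sq: "\<sigma> * \<sigma> * (v\<^sub>p - 1) = 1"
    using vp by (simp add: \<sigma>(1))
  have jump: "u\<^sub>m - u\<^sub>p = \<sigma> * (v\<^sub>p - 1)"
    using \<sigma>(2) vp by (simp add: field_simps)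
  show ?thesis
  proof (cases "\<xi> < 0")
    case True
    have "(u\<^sub>m - u\<^sub>p)\<^sup>2 / (v\<^sub>p - 1) = \<sigma> * \<sigma> * (v\<^sub>p - 1)"
      using vp by (simp add: jump power2_eq_square)
    then have "pbar v\<^sub>p u\<^sub>m u\<^sub>p \<xi> = 1"
      using True sq by (simp only: pbar_def if_True)
    then show ?thesis
      using True by (simp add: vbar_deriv_def vbar_def)
  next
    case False
    let ?v = "vbar \<mu> v\<^sub>p \<xi>"
    have v: "?v \<noteq> 0" using vbar_bounds(1)[of \<xi>] by auto
    have "vbar_deriv \<xi> = \<sigma> / \<mu> * ?v * (v\<^sub>p - ?v)"
      using False vp mu by (simp add: vbar_deriv_def \<sigma>(1) field_simps)
    then have "pbar v\<^sub>p u\<^sub>m u\<^sub>p \<xi> - \<mu> * (1 / ?v * (- \<sigma> * vbar_deriv \<xi>)) = \<sigma> * \<sigma> * (v\<^sub>p - ?v)"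
      using False v mu by (simp add: pbar_def)
    also have "\<dots> = \<sigma> * \<sigma> * (v\<^sub>p - 1) - \<sigma> * \<sigma> * (?v - 1)"
      by (simp add: algebra_simps)
    also have "\<dots> = \<sigma> * (u\<^sub>m - \<sigma> * (?v - 1)) + (1 - \<sigma> * u\<^sub>m)"
      unfolding sq by (simp add: algebra_simps)
    finally show ?thesis .
  qed
qed

lemma congested_wave_limit_solution:
  assumes \<sigma>: "\<sigma> = 1 / sqrt (v\<^sub>p - 1)" "(u\<^sub>m - u\<^sub>p) / (v\<^sub>p - 1) = \<sigma>"
  shows "limit_solution \<mu> (travelling_wave \<sigma> (\<lambda>\<xi>. u\<^sub>m - \<sigma> * (vbar \<mu> v\<^sub>p \<xi> - 1)))
    (travelling_wave \<sigma> (vbar \<mu> v\<^sub>p)) (travelling_wave \<sigma> (pbar v\<^sub>p u\<^sub>m u\<^sub>p))"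
proof -
  let ?v = "vbar \<mu> v\<^sub>p" and ?p = "pbar v\<^sub>p u\<^sub>m u\<^sub>p"
  define u where "u \<xi> = u\<^sub>m - \<sigma> * (?v \<xi> - 1)" for \<xi>
  define u' where "u' \<xi> = - \<sigma> * vbar_deriv \<xi>" for \<xi>
  have u_cont: "continuous_on UNIV u"
    unfolding u_def by (intro continuous_intros continuous_on_vbar)
  have du: "(u has_real_derivative u' \<xi>) (at \<xi>)" if "\<xi> \<notin> {0}" for \<xi>
    using that vbar_has_derivative[of \<xi>] unfolding u_def u'_def by (auto intro!: derivative_eq_intros)
  have v_bd: "\<bar>?v \<xi>\<bar> \<le> v\<^sub>p" for \<xi>
    using vbar_bounds[of \<xi>] by simp
  have u_bd: "\<bar>u \<xi>\<bar> \<le> \<bar>u\<^sub>m\<bar> + \<bar>\<sigma>\<bar> * (v\<^sub>p + 1)" for \<xi>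
  proof -
    have "\<bar>u \<xi>\<bar> \<le> \<bar>u\<^sub>m\<bar> + \<bar>\<sigma>\<bar> * \<bar>?v \<xi> - 1\<bar>"
      unfolding u_def abs_mult[symmetric] by (rule abs_triangle_ineq4)
    also have "\<dots> \<le> \<bar>u\<^sub>m\<bar> + \<bar>\<sigma>\<bar> * (v\<^sub>p + 1)"
      using vbar_bounds[of \<xi>] by (intro add_left_mono mult_left_mono) auto
    finally show ?thesis .
  qed
  have u'_bd: "\<bar>u' \<xi>\<bar> \<le> \<bar>\<sigma>\<bar> * (v\<^sub>p / (\<mu> * sqrt (v\<^sub>p - 1)) * v\<^sub>p)" for \<xi>
    unfolding u'_def abs_mult abs_minus_cancel using vbar_deriv_bounded by (rule mult_left_mono) simp
  have p_bd: "\<bar>?p \<xi>\<bar> \<le> (u\<^sub>m - u\<^sub>p)\<^sup>2 / (v\<^sub>p - 1)" for \<xi>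
    using vp by (simp add: pbar_def)
  have [measurable]: "?v \<in> borel_measurable borel" "u \<in> borel_measurable borel" "vbar_deriv \<in> borel_measurable borel"
    by (rule borel_measurable_continuous_onI[OF continuous_on_vbar] borel_measurable_continuous_onI[OF u_cont]
        vbar_deriv_measurable)+
  have u'_meas[measurable]: "u' \<in> borel_measurable borel" unfolding u'_def by measurable
  have p_meas: "?p \<in> borel_measurable borel" unfolding pbar_def by measurable
  define w where "w \<xi> = 1 / ?v \<xi> * u' \<xi>" for \<xi>
  have w_meas: "w \<in> borel_measurable borel" unfolding w_def by measurable
  have w_bd: "\<bar>w \<xi>\<bar> \<le> \<bar>\<sigma>\<bar> * (v\<^sub>p / (\<mu> * sqrt (v\<^sub>p - 1)) * v\<^sub>p)" for \<xi>
  proof -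
    have "\<bar>w \<xi>\<bar> \<le> 1 * \<bar>u' \<xi>\<bar>"
      unfolding w_def abs_mult using vbar_bounds(1)[of \<xi>] by (intro mult_right_mono) auto
    then show ?thesis using u'_bd[of \<xi>] by simp
  qed
  have flux: "?p \<xi> - \<mu> * (1 / ?v \<xi> * u' \<xi>) = \<sigma> * u \<xi> + (1 - \<sigma> * u\<^sub>m)" for \<xi>
    unfolding u_def u'_def using flux_identity[OF \<sigma>] .
  \<comment> \<open>A constant is a travelling wave with zero derivative, so integration by parts
    makes its flux vanish.\<close>
  have const_flux: "(LINT (t, x)|lborel. c * \<phi>\<^sub>x (t, x)) = 0" if "test_function \<phi> \<phi>\<^sub>t \<phi>\<^sub>x" for c \<phi> \<phi>\<^sub>t \<phi>\<^sub>x
    using travelling_wave_parts[OF that, of "{}" "\<lambda>_. c" "\<bar>c\<bar>" "\<lambda>_. 0" 0 \<sigma>]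
    by (simp add: travelling_wave_def case_prod_beta')
  \<comment> \<open>Common shape of both conservation laws: a wave tested with the transport
    derivative, plus a constant flux.\<close>
  have balance: "(LINT (t, x)|lborel. travelling_wave \<sigma> F t x * (\<phi>\<^sub>t (t, x) + \<sigma> * \<phi>\<^sub>x (t, x)) + c * \<phi>\<^sub>x (t, x)) = 0"
    if test: "test_function \<phi> \<phi>\<^sub>t \<phi>\<^sub>x" and F: "F \<in> borel_measurable borel" "\<And>\<xi>. \<bar>F \<xi>\<bar> \<le> M" for F M c \<phi> \<phi>\<^sub>t \<phi>\<^sub>x
  proof -
    obtain K where K: "compact K" "\<And>z. z \<notin> K \<Longrightarrow> \<phi> z = 0 \<and> \<phi>\<^sub>t z = 0 \<and> \<phi>\<^sub>x z = 0"
      using test_function_support[OF test] by blast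
    note cont = test_function_continuous[OF test]
    have 1: "integrable lborel (\<lambda>(t, x). travelling_wave \<sigma> F t x * (\<phi>\<^sub>t (t, x) + \<sigma> * \<phi>\<^sub>x (t, x)))"
      by (rule integrable_travelling_wave_mult[OF F _ K(1), of "\<lambda>z. \<phi>\<^sub>t z + \<sigma> * \<phi>\<^sub>x z"])
         (use K(2) in \<open>auto intro!: continuous_intros cont\<close>)
    have "integrable lborel (\<lambda>(t, x). travelling_wave \<sigma> (\<lambda>_. c) t x * \<phi>\<^sub>x (t, x))"
      by (rule integrable_travelling_wave_mult[OF _ _ cont(3) K(1), of _ "\<bar>c\<bar>"]) (use K(2) in auto)
    then have 2: "integrable lborel (\<lambda>(t, x). c * \<phi>\<^sub>x (t, x))"
      by (simp add: travelling_wave_def)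
    show ?thesis
      using Bochner_Integration.integral_add[OF 1 2] travelling_wave_transport[OF test F] const_flux[OF test]
      by (simp add: case_prod_beta')
  qed
  have "limit_solution \<mu> (travelling_wave \<sigma> u) (travelling_wave \<sigma> ?v) (travelling_wave \<sigma> ?p)"
    unfolding limit_solution_def
  proof (intro conjI allI impI exI)
    show "locally_integrable (travelling_wave \<sigma> u)" "locally_integrable (travelling_wave \<sigma> ?v)"
      "locally_integrable (travelling_wave \<sigma> ?p)"
      by (rule locally_integrable_travelling_wave[OF _ u_bd] locally_integrable_travelling_wave[OF _ v_bd]
          locally_integrable_travelling_wave[OF p_meas p_bd], measurable?)+
    show "1 \<le> travelling_wave \<sigma> ?v t x" for t x
      using vbar_bounds(1) by (simp add: travelling_wave_def)
    show "(travelling_wave \<sigma> ?v t x - 1) * travelling_wave \<sigma> ?p t x = 0" for t x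
      by (simp add: travelling_wave_def vbar_def pbar_def)
    show "0 \<le> travelling_wave \<sigma> ?p t x" for t x
      using vp by (simp add: travelling_wave_def pbar_def)
    show "weak_dx (travelling_wave \<sigma> u) (travelling_wave \<sigma> u')"
      unfolding weak_dx_def
    proof (intro conjI allI impI)
      show "locally_integrable (travelling_wave \<sigma> u)" "locally_integrable (travelling_wave \<sigma> u')"
        by (rule locally_integrable_travelling_wave[OF _ u_bd] locally_integrable_travelling_wave[OF u'_meas u'_bd], measurable?)+
      fix \<phi> \<phi>\<^sub>t \<phi>\<^sub>x assume test: "test_function \<phi> \<phi>\<^sub>t \<phi>\<^sub>x"
      show "(LINT (t, x)|lborel. travelling_wave \<sigma> u t x * \<phi>\<^sub>x (t, x))
          = - (LINT (t, x)|lborel. travelling_wave \<sigma> u' t x * \<phi> (t, x))"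
        by (rule travelling_wave_parts[where S = "{0}", OF test _ u_cont u_bd u'_meas u'_bd du]) auto
    qed
    have "(\<lambda>t x. 1 / travelling_wave \<sigma> ?v t x * travelling_wave \<sigma> u' t x) = travelling_wave \<sigma> w"
      by (simp add: travelling_wave_def w_def fun_eq_iff)
    then show "locally_integrable (\<lambda>t x. 1 / travelling_wave \<sigma> ?v t x * travelling_wave \<sigma> u' t x)"
      using locally_integrable_travelling_wave[OF w_meas w_bd] by simp
    fix \<phi> \<phi>\<^sub>t \<phi>\<^sub>x assume test: "test_function \<phi> \<phi>\<^sub>t \<phi>\<^sub>x"
    \<comment> \<open>Substituting \<open>u = u\<^sub>m + \<sigma> - \<sigma> * v\<close> brings the
      mass equation into that shape; \<open>flux\<close> does so for the momentum equation
      below.\<close>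
    have "(\<lambda>(t, x). travelling_wave \<sigma> ?v t x * \<phi>\<^sub>t (t, x) - travelling_wave \<sigma> u t x * \<phi>\<^sub>x (t, x))
      = (\<lambda>(t, x). travelling_wave \<sigma> ?v t x * (\<phi>\<^sub>t (t, x) + \<sigma> * \<phi>\<^sub>x (t, x)) + - (u\<^sub>m + \<sigma>) * \<phi>\<^sub>x (t, x))"
      by (auto simp: travelling_wave_def u_def algebra_simps)
    then show "(LINT (t, x)|lborel. travelling_wave \<sigma> ?v t x * \<phi>\<^sub>t (t, x) - travelling_wave \<sigma> u t x * \<phi>\<^sub>x (t, x)) = 0"
      using balance[OF test _ v_bd] by simp
    have "travelling_wave \<sigma> u t x * \<phi>\<^sub>t (t, x) + travelling_wave \<sigma> ?p t x * \<phi>\<^sub>x (t, x)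
          - \<mu> * (1 / travelling_wave \<sigma> ?v t x * travelling_wave \<sigma> u' t x) * \<phi>\<^sub>x (t, x)
        = travelling_wave \<sigma> u t x * (\<phi>\<^sub>t (t, x) + \<sigma> * \<phi>\<^sub>x (t, x)) + (1 - \<sigma> * u\<^sub>m) * \<phi>\<^sub>x (t, x)" for t x
    proof -
      let ?y = "x - \<sigma> * t"
      have "u ?y * \<phi>\<^sub>t (t, x) + ?p ?y * \<phi>\<^sub>x (t, x) - \<mu> * (1 / ?v ?y * u' ?y) * \<phi>\<^sub>x (t, x)
          = u ?y * \<phi>\<^sub>t (t, x) + (?p ?y - \<mu> * (1 / ?v ?y * u' ?y)) * \<phi>\<^sub>x (t, x)"
        by (simp only: left_diff_distrib)
      also have "\<dots> = u ?y * (\<phi>\<^sub>t (t, x) + \<sigma> * \<phi>\<^sub>x (t, x)) + (1 - \<sigma> * u\<^sub>m) * \<phi>\<^sub>x (t, x)"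
        unfolding flux by (simp add: algebra_simps)
      finally show ?thesis by (simp only: travelling_wave_def)
    qed
    then show "(LINT (t, x)|lborel. travelling_wave \<sigma> u t x * \<phi>\<^sub>t (t, x) + travelling_wave \<sigma> ?p t x * \<phi>\<^sub>x (t, x)
        - \<mu> * (1 / travelling_wave \<sigma> ?v t x * travelling_wave \<sigma> u' t x) * \<phi>\<^sub>x (t, x)) = 0"
      using balance[OF test _ u_bd] by (simp only:) simp
  qed
  then show ?thesis by (simp only: u_def[abs_def])
qed

end

section \<open>The singular limit\<close>

text \<open>The pressure drop in units of \<open>\<delta>\<close>: linear for small
  \<open>y\<close>, saturating for large \<open>y\<close>. Both bounds come from
  \<open>exp x \<ge> 1 + x\<close>, combined with an upper, respectively a lower, bound on the
  logarithm.\<close>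

lemma one_minus_powr_bounds:
  fixes \<gamma> y :: real
  assumes "\<gamma> > 0" "y \<ge> 0"
  shows "1 - (1 + y) powr (- \<gamma>) \<le> \<gamma> * y"
    and "\<gamma> / (2 + \<gamma>) * min 1 y \<le> 1 - (1 + y) powr (- \<gamma>)"
proof -
  have ln_le: "ln (1 + y) \<le> y" using assms by (simp add: ln_add_one_self_le_self)
  have "1 - \<gamma> * y \<le> 1 + (- \<gamma> * ln (1 + y))"
    using ln_le assms by simp
  also have "\<dots> \<le> exp (- \<gamma> * ln (1 + y))" by (rule exp_ge_add_one_self)
  also have "\<dots> = (1 + y) powr (- \<gamma>)" using assms by (simp add: powr_def)
  finally show "1 - (1 + y) powr (- \<gamma>) \<le> \<gamma> * y" by simp
  \<comment> \<open>From \<open>ln (1 + z) \<ge> z / 2\<close> on the unit interval follows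
    \<open>(1 + z) powr \<gamma> \<ge> 1 + \<gamma> * z / 2\<close>. So the drop is at least
    \<open>\<gamma> * z / (2 + \<gamma> * z)\<close>, and \<open>z \<le> 1\<close> in the
    denominator yields the constant.\<close>
  have small: "\<gamma> / (2 + \<gamma>) * z \<le> 1 - (1 + z) powr (- \<gamma>)" if z: "0 \<le> z" "z \<le> 1" for z
  proof -
    have "ln (inverse (1 + z)) \<le> inverse (1 + z) - 1"
      using z by (intro ln_le_minus_one) auto
    moreover have "ln (inverse (1 + z)) = - ln (1 + z)" "inverse (1 + z) - 1 = - (z / (1 + z))"
      using z by (simp_all add: ln_inverse) (simp add: field_simps)
    ultimately have "z / (1 + z) \<le> ln (1 + z)" by linarith
    moreover have "z / 2 \<le> z / (1 + z)"
      using z by (intro divide_left_mono) auto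
    ultimately have ln_ge: "z / 2 \<le> ln (1 + z)" by linarith
    have "1 + \<gamma> * (z / 2) \<le> 1 + \<gamma> * ln (1 + z)"
      using ln_ge assms(1) by (intro add_left_mono mult_left_mono) auto
    also have "\<dots> \<le> exp (\<gamma> * ln (1 + z))" by (rule exp_ge_add_one_self)
    also have "\<dots> = (1 + z) powr \<gamma>" using z by (simp add: powr_def)
    finally have "(1 + z) powr (- \<gamma>) \<le> 1 / (1 + \<gamma> * (z / 2))"
      unfolding powr_minus_divide using assms(1) z by (intro divide_left_mono mult_pos_pos) (auto intro: add_pos_nonneg)
    also have "\<dots> \<le> 1 - \<gamma> / (2 + \<gamma>) * z"
    proof -
      have "\<gamma> / (2 + \<gamma>) * z \<le> \<gamma> * z / (2 + \<gamma> * z)"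
        using assms(1) z by (simp add: divide_left_mono add_pos_nonneg mult_left_le)
      also have "\<dots> = 1 - 1 / (1 + \<gamma> * (z / 2))"
      proof -
        have "2 + \<gamma> * z > 0" using assms(1) z by (simp add: add_pos_nonneg)
        then show ?thesis by (simp add: field_simps)
      qed
      finally show ?thesis by simp
    qed
    finally show ?thesis by simp
  qed
  show "\<gamma> / (2 + \<gamma>) * min 1 y \<le> 1 - (1 + y) powr (- \<gamma>)"
  \<comment> \<open>Beyond 1 the drop only grows, so its value at 1 serves as the bound.\<close>
  proof (cases "y \<le> 1")
    case True then show ?thesis using small[of y] assms by simp
  next
    case False
    then have "(1 + y) powr (- \<gamma>) \<le> (1 + 1) powr (- \<gamma>)"
      using assms(1) by (intro powr_mono2') auto
    then show ?thesis using small[of 1] False by simp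
  qed
qed

section \<open>Uniform bounds on the profile field in the congested scaling\<close>

context viscous_shock
begin

text \<open>The choice \<open>\<epsilon> = \<delta> powr \<gamma>\<close> normalises the left
  pressure to 1, so the nonlinearity depends only on the distance to \<open>v\<^sub>m\<close>
  measured in units of \<open>\<delta>\<close>.\<close>

lemma chord_gap_scaled:
  assumes "\<delta> > 0" "v\<^sub>m = 1 + \<delta>" "\<epsilon> = \<delta> powr \<gamma>" "v\<^sub>m < v"
  shows "chord_gap v = 1 - (1 + (v - v\<^sub>m) / \<delta>) powr (- \<gamma>) - s\<^sup>2 * (v - v\<^sub>m)"
proof -
  have v: "v - 1 = \<delta> * (1 + (v - v\<^sub>m) / \<delta>)" "v\<^sub>m - 1 = \<delta>"
    using assms by (simp_all add: field_simps)
  have unit: "\<delta> powr \<gamma> * \<delta> powr (- \<gamma>) = 1"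
    using assms(1) by (simp add: powr_add[symmetric])
  have "(v - 1) powr (- \<gamma>) = \<delta> powr (- \<gamma>) * (1 + (v - v\<^sub>m) / \<delta>) powr (- \<gamma>)"
    unfolding v(1) using assms(1,4) by (intro powr_mult)
  then have "pressure \<gamma> \<epsilon> v = (1 + (v - v\<^sub>m) / \<delta>) powr (- \<gamma>)"
    unfolding pressure_def assms(3) by (simp only: mult.assoc[symmetric] unit mult_1_left)
  moreover have "pressure \<gamma> \<epsilon> v\<^sub>m = 1"
    unfolding pressure_def assms(3) v(2) by (rule unit)
  ultimately show ?thesis
    by (simp add: chord_gap_def algebra_simps)
qed

text \<open>Discarding the subtracted term \<open>s\<^sup>2 * (v - v\<^sub>m)\<close> leaves the
  pressure drop. A lower bound \<open>a\<close> on the speed keeps the coefficient of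
  \<open>1 / \<delta>\<close> independent of \<open>\<epsilon>\<close>.\<close>

lemma profile_field_upper:
  assumes scale: "\<delta> > 0" "v\<^sub>m = 1 + \<delta>" "\<epsilon> = \<delta> powr \<gamma>"
    and v: "v\<^sub>m < v" "v < v\<^sub>p" and "0 < a" "a \<le> s"
  shows "profile_field v \<le> v\<^sub>p * \<gamma> / (\<mu> * a) / \<delta> * (v - v\<^sub>m)"
proof -
  have "s\<^sup>2 * (v - v\<^sub>m) \<ge> 0" "(v - v\<^sub>m) / \<delta> \<ge> 0" using v scale(1) by simp_all
  then have "chord_gap v \<le> \<gamma> * ((v - v\<^sub>m) / \<delta>)"
    using one_minus_powr_bounds(1)[OF gamma, of "(v - v\<^sub>m) / \<delta>"] chord_gap_scaled[OF scale v(1)]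
    by linarith
  then have "profile_field v \<le> v\<^sub>p / (\<mu> * a) * (\<gamma> * ((v - v\<^sub>m) / \<delta>))"
    unfolding profile_field_def using mu s vm v assms(6,7) chord_gap_pos[OF v]
    by (intro mult_mono frac_le) auto
  then show ?thesis by simp
qed

text \<open>The smallness assumptions let the subtracted linear term consume at most half of the
  pressure drop, which explains the 2 in the constant. The prefactor \<open>v\<close> is bounded
  below by 1.\<close>

lemma profile_field_lower:
  assumes scale: "\<delta> > 0" "v\<^sub>m = 1 + \<delta>" "\<epsilon> = \<delta> powr \<gamma>"
    and v: "v\<^sub>m < v" "v < v\<^sub>p" and b: "s \<le> b"
    and small: "b\<^sup>2 * (v - v\<^sub>m) \<le> \<gamma> / (2 + \<gamma>) / 2" "b\<^sup>2 * \<delta> \<le> \<gamma> / (2 + \<gamma>) / 2"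
  shows "\<gamma> / (2 + \<gamma>) / (2 * \<mu> * b) * min 1 ((v - v\<^sub>m) / \<delta>) \<le> profile_field v"
proof -
  let ?y = "(v - v\<^sub>m) / \<delta>"
  define k where "k = \<gamma> / (2 + \<gamma>)"
  define m where "m = min 1 ?y"
  have k: "k > 0" using gamma by (simp add: k_def)
  have y: "?y \<ge> 0" using v scale(1) by simp
  have m: "m \<ge> 0" using y by (simp add: m_def)
  have s2: "s\<^sup>2 \<le> b\<^sup>2" using s b by (intro power_mono) auto
  \<comment> \<open>Where \<open>m = ?y\<close>, the term equals
    \<open>s\<^sup>2 * \<delta> * ?y\<close> and smallness of \<open>\<delta>\<close> is used; where
    \<open>m = 1\<close>, smallness of \<open>v - v\<^sub>m\<close> itself.\<close>
  have "s\<^sup>2 * (v - v\<^sub>m) \<le> k / 2 * m"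
  proof (cases "?y \<le> 1")
    case True
    have "s\<^sup>2 * \<delta> \<le> k / 2"
      using mult_right_mono[OF s2, of \<delta>] scale(1) small(2) unfolding k_def by linarith
    then have "s\<^sup>2 * \<delta> * ?y \<le> k / 2 * ?y"
      using y by (rule mult_right_mono)
    then show ?thesis using True scale(1) by (simp add: m_def)
  next
    case False
    have "s\<^sup>2 * (v - v\<^sub>m) \<le> k / 2"
      using mult_right_mono[OF s2, of "v - v\<^sub>m"] v small(1) unfolding k_def by linarith
    then show ?thesis using False by (simp add: m_def)
  qed
  moreover have "k * m \<le> 1 - (1 + ?y) powr (- \<gamma>)"
    unfolding k_def m_def by (rule one_minus_powr_bounds(2)[OF gamma y])
  ultimately have "k / 2 * m \<le> chord_gap v"
    unfolding chord_gap_scaled[OF scale v(1)] by (simp add: field_simps)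
  then have "1 / (\<mu> * b) * (k / 2 * m) \<le> profile_field v"
    unfolding profile_field_def using mu s vm v b k m
    by (intro mult_mono frac_le) auto
  then have "k / (2 * \<mu> * b) * m \<le> profile_field v"
    by (simp add: mult_ac)
  then show ?thesis by (simp only: k_def m_def)
qed

end

text \<open>Comparison with exponentials without solving the equation: \<open>w\<close> times an
  exponential weight of rate \<open>A / \<delta>\<close> is nonincreasing, and with rate
  \<open>B / \<delta>\<close> it is nondecreasing as long as
  \<open>w \<le> \<delta>\<close>.\<close>

lemma backward_decay:
  fixes w f :: "real \<Rightarrow> real"
  assumes \<delta>: "\<delta> > 0" and A: "A > 0" and B: "B > 0" and w: "\<And>\<xi>. w \<xi> > 0" "w 0 \<ge> \<delta>"
    and dw: "\<And>\<xi>. (w has_real_derivative f \<xi>) (at \<xi>)"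
    and upper: "\<And>\<xi>. \<xi> \<le> 0 \<Longrightarrow> f \<xi> \<le> A / \<delta> * w \<xi>"
    and lower: "\<And>\<xi>. \<xi> \<le> 0 \<Longrightarrow> f \<xi> \<ge> B * min 1 (w \<xi> / \<delta>)"
    and \<xi>: "\<xi> < - 2 * w 0 / B"
  shows "\<delta> * exp (A / \<delta> * \<xi>) \<le> w \<xi>" and "w \<xi> \<le> \<delta> * exp (B / 2 / \<delta> * \<xi>)"
proof -
  \<comment> \<open>If \<open>w\<close> stayed above \<open>\<delta>\<close> back to
    \<open>\<xi>\<^sub>1\<close>, its slope would be at least \<open>B\<close> throughout and
    \<open>w\<close> would have dropped from \<open>w 0\<close> to 0 there.\<close>
  define \<xi>\<^sub>1 where "\<xi>\<^sub>1 = - w 0 / B"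
  have \<xi>1: "\<xi>\<^sub>1 \<le> 0" "\<xi> < 2 * \<xi>\<^sub>1"
    using w(1)[of 0] B \<xi> by (auto simp: \<xi>\<^sub>1_def)
  have f_nonneg: "f \<eta> \<ge> 0" if "\<eta> \<le> 0" for \<eta>
    using order_trans[OF _ lower[OF that]] B \<delta> w(1)[of \<eta>] by simp
  have w_mono: "w \<eta> \<le> w \<zeta>" if "\<eta> \<le> \<zeta>" "\<zeta> \<le> 0" for \<eta> \<zeta>
    by (rule DERIV_nonneg_imp_nondecreasing[OF that(1)]) (use dw f_nonneg that in force)
  have "w 0 * exp (- (A / \<delta>) * 0) \<le> w \<xi> * exp (- (A / \<delta>) * \<xi>)"
  proof (rule DERIV_nonpos_imp_nonincreasing[where f = "\<lambda>x. w x * exp (- (A / \<delta>) * x)"])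
    show "\<xi> \<le> 0" using \<xi>1 by linarith
    fix x :: real assume x: "x \<le> 0"
    have "((\<lambda>x. w x * exp (- (A / \<delta>) * x)) has_real_derivative
        (f x - A / \<delta> * w x) * exp (- (A / \<delta>) * x)) (at x)"
      using \<delta> by (auto intro!: derivative_eq_intros dw simp: algebra_simps)
    moreover have "(f x - A / \<delta> * w x) * exp (- (A / \<delta>) * x) \<le> 0"
      using upper[OF x] by (simp add: mult_le_0_iff)
    ultimately show "\<exists>y. ((\<lambda>x. w x * exp (- (A / \<delta>) * x)) has_real_derivative y) (at x) \<and> y \<le> 0"
      by blast
  qed
  then have "\<delta> \<le> w \<xi> * exp (- (A / \<delta> * \<xi>))"
    using w(2) by simp
  then show "\<delta> * exp (A / \<delta> * \<xi>) \<le> w \<xi>"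
    by (simp add: exp_minus field_simps)
  have w1: "w \<xi>\<^sub>1 \<le> \<delta>"
  proof (rule ccontr)
    assume "\<not> w \<xi>\<^sub>1 \<le> \<delta>"
    then have big: "w \<eta> \<ge> \<delta>" if "\<xi>\<^sub>1 \<le> \<eta>" "\<eta> \<le> 0" for \<eta>
      using w_mono[OF that] by linarith
    have "w \<xi>\<^sub>1 - B * \<xi>\<^sub>1 \<le> w 0 - B * 0"
    proof (rule DERIV_nonneg_imp_nondecreasing[where f = "\<lambda>x. w x - B * x", OF \<xi>1(1)])
      fix x assume x: "\<xi>\<^sub>1 \<le> x" "x \<le> 0"
      have "((\<lambda>x. w x - B * x) has_real_derivative f x - B) (at x)"
        by (auto intro!: derivative_eq_intros dw)
      moreover have "f x - B \<ge> 0"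
        using lower[OF x(2)] big[OF x] \<delta> by simp
      ultimately show "\<exists>y. ((\<lambda>x. w x - B * x) has_real_derivative y) (at x) \<and> 0 \<le> y" by blast
    qed
    then have "w \<xi>\<^sub>1 \<le> 0" using B by (simp add: \<xi>\<^sub>1_def)
    then show False using w(1)[of \<xi>\<^sub>1] by simp
  qed
  have "w \<xi> * exp (- (B / \<delta>) * \<xi>) \<le> w \<xi>\<^sub>1 * exp (- (B / \<delta>) * \<xi>\<^sub>1)"
  proof (rule DERIV_nonneg_imp_nondecreasing[where f = "\<lambda>x. w x * exp (- (B / \<delta>) * x)"])
    show "\<xi> \<le> \<xi>\<^sub>1" using \<xi>1 by linarith
    fix x assume x: "x \<le> \<xi>\<^sub>1"
    have "((\<lambda>x. w x * exp (- (B / \<delta>) * x)) has_real_derivative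
        (f x - B / \<delta> * w x) * exp (- (B / \<delta>) * x)) (at x)"
      using \<delta> by (auto intro!: derivative_eq_intros dw simp: algebra_simps)
    moreover have "f x \<ge> B / \<delta> * w x"
    proof -
      have "w x \<le> \<delta>" using w_mono[OF x \<xi>1(1)] w1 by linarith
      then show ?thesis using lower[of x] x \<xi>1(1) \<delta> by simp
    qed
    ultimately show "\<exists>y. ((\<lambda>x. w x * exp (- (B / \<delta>) * x)) has_real_derivative y) (at x) \<and> 0 \<le> y"
      by (meson diff_ge_0_iff_ge exp_ge_zero mult_nonneg_nonneg)
  qed
  also have "\<dots> \<le> \<delta> * exp (- (B / \<delta>) * \<xi>\<^sub>1)"
    using w1 by simp
  finally have "w \<xi> \<le> \<delta> * exp (- (B / \<delta>) * \<xi>\<^sub>1) * exp (B / \<delta> * \<xi>)"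
    by (simp add: exp_minus field_simps)
  also have "\<dots> = \<delta> * exp (B / \<delta> * (\<xi> - \<xi>\<^sub>1))"
    using \<delta> by (simp add: mult_exp_exp field_simps)
  also have "\<dots> \<le> \<delta> * exp (B / 2 / \<delta> * \<xi>)"
  proof -
    \<comment> \<open>Because \<open>\<xi> < 2 * \<xi>\<^sub>1\<close>, the distance already decayed
      is at least half of the distance to 0; this costs half of the rate.\<close>
    have "B / \<delta> * (\<xi> - \<xi>\<^sub>1) \<le> B / \<delta> * (\<xi> / 2)"
      using \<xi>1 B \<delta> by (intro mult_left_mono) auto
    then show ?thesis using \<delta> by (simp add: field_simps)
  qed
  finally show "w \<xi> \<le> \<delta> * exp (B / 2 / \<delta> * \<xi>)" .
qed

section \<open>Families of profiles as the parameter tends to zero\<close>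

lemma tendsto_powr_at_right_0:
  fixes a :: real
  assumes "a > 0"
  shows "((\<lambda>x::real. x powr a) \<longlongrightarrow> 0) (at_right 0)"
  using assms by (intro tendsto_zero_powrI[OF tendsto_ident_at tendsto_const])
    (auto simp: eventually_at_filter)

lemma volume_profiles_shock:
  assumes "\<mu> > 0" "\<gamma> > 0" "volume_profiles \<mu> \<gamma> v\<^sub>p V"
  shows "\<forall>\<^sub>F \<epsilon> in at_right 0. \<epsilon> > 0 \<and> (\<exists>s. viscous_shock \<mu> \<gamma> \<epsilon> (1 + \<epsilon> powr (1 / \<gamma>)) v\<^sub>p s \<and>
    (\<forall>\<xi>. V \<epsilon> \<xi> \<in> {1 + \<epsilon> powr (1 / \<gamma>)<..<v\<^sub>p} \<and>
      (V \<epsilon> has_real_derivative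
        viscous_shock.profile_field \<mu> \<gamma> \<epsilon> (1 + \<epsilon> powr (1 / \<gamma>)) s (V \<epsilon> \<xi>)) (at \<xi>)) \<and>
    (V \<epsilon> \<longlongrightarrow> 1 + \<epsilon> powr (1 / \<gamma>)) at_bot \<and> (V \<epsilon> \<longlongrightarrow> v\<^sub>p) at_top)"
  using assms(3)[unfolded volume_profiles_def] eventually_at_right_less[of 0]
proof eventually_elim
  case (elim \<epsilon>)
  then obtain u\<^sub>m u\<^sub>p s U where
    states: "front_states (pressure \<gamma> \<epsilon>) (1 + \<epsilon> powr (1 / \<gamma>)) v\<^sub>p u\<^sub>m u\<^sub>p" and
    front: "travelling_front \<mu> (pressure \<gamma> \<epsilon>) (1 + \<epsilon> powr (1 / \<gamma>)) v\<^sub>p u\<^sub>m u\<^sub>p s U (V \<epsilon>)"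
    by blast
  note prof = travelling_front_profile[OF assms(1,2) elim(2) states front]
  have "(travelling_wave s (V \<epsilon>) 0 \<longlongrightarrow> 1 + \<epsilon> powr (1 / \<gamma>)) at_bot"
    "(travelling_wave s (V \<epsilon>) 0 \<longlongrightarrow> v\<^sub>p) at_top"
    using front unfolding travelling_front_def by blast+
  then have "(V \<epsilon> \<longlongrightarrow> 1 + \<epsilon> powr (1 / \<gamma>)) at_bot" "(V \<epsilon> \<longlongrightarrow> v\<^sub>p) at_top"
    by (simp_all add: travelling_wave_def)
  then show ?case
    using prof(2,4,5) elim(2) by blast
qed

text \<open>Since the infimum over the shift is taken for each \<open>\<xi>\<close> separately, only the ranges of the two profiles matter.\<close>

lemma volume_profiles_converge:
  assumes mu: "\<mu> > 0" and gamma: "\<gamma> > 0" and vp: "v\<^sub>p > 1" and V: "volume_profiles \<mu> \<gamma> v\<^sub>p V"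
  shows "((\<lambda>\<epsilon>. SUP \<xi>. INF C. ereal \<bar>V \<epsilon> (\<xi> + C) - vbar \<mu> v\<^sub>p \<xi>\<bar>) \<longlongrightarrow> 0) (at_right 0)"
proof (rule tendsto_sandwich)
  show "((\<lambda>\<epsilon>. 0 :: ereal) \<longlongrightarrow> 0) (at_right (0::real))" by simp
  have "((\<lambda>\<epsilon>. ereal (2 * \<epsilon> powr (1 / \<gamma>))) \<longlongrightarrow> ereal (2 * 0)) (at_right 0)"
    by (intro tendsto_ereal tendsto_intros tendsto_powr_at_right_0) (use gamma in simp)
  then show "((\<lambda>\<epsilon>. ereal (2 * \<epsilon> powr (1 / \<gamma>))) \<longlongrightarrow> 0) (at_right 0)"
    by (simp add: zero_ereal_def)
  have "0 \<le> (INF C. ereal \<bar>V \<epsilon> (0 + C) - vbar \<mu> v\<^sub>p 0\<bar>)" for \<epsilon>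
    by (rule INF_greatest) simp
  then show "\<forall>\<^sub>F \<epsilon> in at_right 0. 0 \<le> (SUP \<xi>. INF C. ereal \<bar>V \<epsilon> (\<xi> + C) - vbar \<mu> v\<^sub>p \<xi>\<bar>)"
    by (intro always_eventually allI SUP_upper2[of 0]) auto
  show "\<forall>\<^sub>F \<epsilon> in at_right 0. (SUP \<xi>. INF C. ereal \<bar>V \<epsilon> (\<xi> + C) - vbar \<mu> v\<^sub>p \<xi>\<bar>)
      \<le> ereal (2 * \<epsilon> powr (1 / \<gamma>))"
    using volume_profiles_shock[OF mu gamma V]
  proof eventually_elim
    case (elim \<epsilon>)
    define \<delta> where "\<delta> = \<epsilon> powr (1 / \<gamma>)"
    have \<delta>: "\<delta> > 0" using elim by (simp add: \<delta>_def)
    from elim have range: "V \<epsilon> \<xi> > 1 + \<delta>"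
      and cont: "isCont (V \<epsilon>) \<xi>" and lim: "(V \<epsilon> \<longlongrightarrow> 1 + \<delta>) at_bot" "(V \<epsilon> \<longlongrightarrow> v\<^sub>p) at_top" for \<xi>
      unfolding \<delta>_def by (auto intro: DERIV_isCont)
    \<comment> \<open>The profile has a value below \<open>1 + 2 * \<delta>\<close> and one above
      \<open>y\<close>. Either \<open>y\<close> is attained between them, or \<open>y\<close> lies
      under the first value, and both are then in an interval of length
      \<open>2 * \<delta>\<close>.\<close>
    have close: "\<exists>\<eta>. \<bar>V \<epsilon> \<eta> - y\<bar> \<le> 2 * \<delta>" if y: "1 \<le> y" "y < v\<^sub>p" for y
    proof -
      have "\<forall>\<^sub>F \<eta> in at_bot. V \<epsilon> \<eta> < 1 + 2 * \<delta>" "\<forall>\<^sub>F \<eta> in at_top. V \<epsilon> \<eta> > y"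
        using order_tendstoD(2)[OF lim(1), of "1 + 2 * \<delta>"] order_tendstoD(1)[OF lim(2) y(2)] \<delta> by auto
      then obtain \<eta> \<zeta> where \<eta>: "V \<epsilon> \<eta> < 1 + 2 * \<delta>" and \<zeta>: "V \<epsilon> \<zeta> > y"
        by (meson eventually_happens trivial_limit_at_top_linorder trivial_limit_at_bot_linorder)
      show ?thesis
      proof (cases "V \<epsilon> \<eta> \<le> y")
        case True
        have "connected (range (V \<epsilon>))"
          using cont by (intro connected_continuous_image continuous_at_imp_continuous_on) auto
        then have "y \<in> range (V \<epsilon>)"
          using connectedD_interval[of "range (V \<epsilon>)" "V \<epsilon> \<eta>" "V \<epsilon> \<zeta>" y] True \<zeta> by auto
        then obtain \<theta> where "V \<epsilon> \<theta> = y" by blast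
        then show ?thesis using \<delta> by (intro exI[of _ \<theta>]) simp
      next
        case False
        then show ?thesis using \<eta> y by (intro exI[of _ \<eta>]) auto
      qed
    qed
    have "(INF C. ereal \<bar>V \<epsilon> (\<xi> + C) - vbar \<mu> v\<^sub>p \<xi>\<bar>) \<le> ereal (2 * \<delta>)" for \<xi>
    proof -
      obtain \<eta> where \<eta>: "\<bar>V \<epsilon> \<eta> - vbar \<mu> v\<^sub>p \<xi>\<bar> \<le> 2 * \<delta>"
        using close vbar_bounds[OF mu vp] by blast
      show ?thesis
        by (rule INF_lower2[of "\<eta> - \<xi>"]) (use \<eta> in auto)
    qed
    then show ?case
      unfolding \<delta>_def by (intro SUP_least) auto
  qed
qed

text \<open>The left pressure is 1 and the right pressure vanishes in the limit, so Rankine-Hugoniot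
  gives \<open>s\<^sup>2 \<longlongrightarrow> 1 / (v\<^sub>p - 1)\<close>. A factor 4 on either
  side of this limit becomes the factor 2 for \<open>s\<close>.\<close>

lemma shock_speed_bounds:
  assumes "\<mu> > 0" "\<gamma> > 0" "v\<^sub>p > 1"
  shows "\<forall>\<^sub>F \<epsilon> in at_right 0. \<forall>s. viscous_shock \<mu> \<gamma> \<epsilon> (1 + \<epsilon> powr (1 / \<gamma>)) v\<^sub>p s \<longrightarrow>
    1 / (2 * sqrt (v\<^sub>p - 1)) \<le> s \<and> s \<le> 2 / sqrt (v\<^sub>p - 1)"
proof -
  let ?S = "\<lambda>\<epsilon>. (1 - \<epsilon> * (v\<^sub>p - 1) powr (- \<gamma>)) / (v\<^sub>p - (1 + \<epsilon> powr (1 / \<gamma>)))"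
  have "(?S \<longlongrightarrow> (1 - 0 * (v\<^sub>p - 1) powr (- \<gamma>)) / (v\<^sub>p - (1 + 0))) (at_right 0)"
    using assms by (intro tendsto_intros tendsto_powr_at_right_0) auto
  then have lim: "(?S \<longlongrightarrow> 1 / (v\<^sub>p - 1)) (at_right 0)" by simp
  have "1 / (4 * (v\<^sub>p - 1)) < 1 / (v\<^sub>p - 1)" "1 / (v\<^sub>p - 1) < 4 / (v\<^sub>p - 1)"
    using assms(3) by (auto simp: field_simps)
  then have "\<forall>\<^sub>F \<epsilon> in at_right 0. 1 / (4 * (v\<^sub>p - 1)) < ?S \<epsilon>" "\<forall>\<^sub>F \<epsilon> in at_right 0. ?S \<epsilon> < 4 / (v\<^sub>p - 1)"
    using order_tendstoD[OF lim] by blast+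
  then show ?thesis
  proof eventually_elim
    case (elim \<epsilon>)
    show ?case
    proof (intro allI impI)
      fix s assume "viscous_shock \<mu> \<gamma> \<epsilon> (1 + \<epsilon> powr (1 / \<gamma>)) v\<^sub>p s"
      then interpret viscous_shock \<mu> \<gamma> \<epsilon> "1 + \<epsilon> powr (1 / \<gamma>)" v\<^sub>p s .
      have "pressure \<gamma> \<epsilon> (1 + \<epsilon> powr (1 / \<gamma>)) = 1"
        using eps gamma by (simp add: pressure_def powr_powr powr_minus)
      then have s2: "s\<^sup>2 = ?S \<epsilon>"
        using rankine_hugoniot vmp by (simp add: pressure_def field_simps)
      have "(1 / (2 * sqrt (v\<^sub>p - 1)))\<^sup>2 = 1 / (4 * (v\<^sub>p - 1))" "(2 / sqrt (v\<^sub>p - 1))\<^sup>2 = 4 / (v\<^sub>p - 1)"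
        using assms(3) by (simp_all add: power_divide power_mult_distrib)
      then have "(1 / (2 * sqrt (v\<^sub>p - 1)))\<^sup>2 \<le> s\<^sup>2" "s\<^sup>2 \<le> (2 / sqrt (v\<^sub>p - 1))\<^sup>2"
        using elim s2 by linarith+
      then show "1 / (2 * sqrt (v\<^sub>p - 1)) \<le> s \<and> s \<le> 2 / sqrt (v\<^sub>p - 1)"
        using s assms(3) by (auto intro: power2_le_imp_le)
    qed
  qed
qed

text \<open>The remaining work is to meet the hypotheses of \<open>backward_decay\<close> with
  constants free of \<open>\<epsilon>\<close>, applied to the excess over the left state.\<close>

lemma volume_profiles_decay:
  assumes mu: "\<mu> > 0" and gamma: "\<gamma> > 0" and vp: "v\<^sub>p > 1" and V: "volume_profiles \<mu> \<gamma> v\<^sub>p V" and c: "c > 0"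
    and V0: "\<forall>\<^sub>F \<epsilon> in at_right 0. V \<epsilon> 0 - 1 = c * \<epsilon> powr (1 / (\<gamma> + 1))"
  obtains Cup Clow \<sigma>up \<sigma>low :: real and \<xi>\<^sub>0 :: "real \<Rightarrow> real"
  where "Cup > 0" "Clow > 0" "\<sigma>up > 0" "\<sigma>low > 0" "(\<xi>\<^sub>0 \<longlongrightarrow> 0) (at_right 0)"
    "\<forall>\<^sub>F \<epsilon> in at_right 0. \<forall>\<xi> < \<xi>\<^sub>0 \<epsilon>.
       Clow * \<epsilon> powr (1 / \<gamma>) * exp (\<sigma>low * \<epsilon> powr (- 1 / \<gamma>) * \<xi>) \<le> V \<epsilon> \<xi> - (1 + \<epsilon> powr (1 / \<gamma>)) \<and>
       V \<epsilon> \<xi> - (1 + \<epsilon> powr (1 / \<gamma>)) \<le> Cup * \<epsilon> powr (1 / \<gamma>) * exp (\<sigma>up * \<epsilon> powr (- 1 / \<gamma>) * \<xi>)"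
proof -
  \<comment> \<open>\<open>a\<close> and \<open>b\<close> are the uniform speed bounds,
    \<open>A\<close> and \<open>B\<close> the resulting constants of the upper and lower field
    estimates, \<open>k\<close> the smallness threshold of the latter.\<close>
  define a where "a = 1 / (2 * sqrt (v\<^sub>p - 1))"
  define b where "b = 2 / sqrt (v\<^sub>p - 1)"
  define A where "A = v\<^sub>p * \<gamma> / (\<mu> * a)"
  define B where "B = \<gamma> / (2 + \<gamma>) / (2 * \<mu> * b)"
  define k where "k = \<gamma> / (2 + \<gamma>) / 2"
  define W where "W \<epsilon> = c * \<epsilon> powr (1 / (\<gamma> + 1))" for \<epsilon>
  have pos: "a > 0" "b > 0" "A > 0" "B > 0" "k > 0"
    using mu gamma vp by (auto simp: a_def b_def A_def B_def k_def)
  have W_lim: "(W \<longlongrightarrow> 0) (at_right 0)"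
    unfolding W_def using gamma
    by (intro tendsto_mult_right_zero tendsto_powr_at_right_0) auto
  have "((\<lambda>\<epsilon>. b\<^sup>2 * W \<epsilon>) \<longlongrightarrow> 0) (at_right 0)"
    by (intro tendsto_mult_right_zero W_lim)
  then have W_small: "\<forall>\<^sub>F \<epsilon> in at_right 0. b\<^sup>2 * W \<epsilon> < k"
    using order_tendstoD(2) pos(5) by blast
  \<comment> \<open>The prescribed height \<open>W \<epsilon>\<close> at the origin is of larger
    order than \<open>\<delta>\<close>; eventually \<open>2 * \<delta> \<le> W \<epsilon>\<close>,
    so the excess \<open>W \<epsilon> - \<delta>\<close> over the left state is at least
    \<open>\<delta>\<close>, where the backward comparison starts.\<close>
  have "1 / \<gamma> - 1 / (\<gamma> + 1) > 0"
    using gamma by (simp add: frac_less2)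
  then have "((\<lambda>\<epsilon>::real. \<epsilon> powr (1 / \<gamma> - 1 / (\<gamma> + 1))) \<longlongrightarrow> 0) (at_right 0)"
    by (rule tendsto_powr_at_right_0)
  then have scales: "\<forall>\<^sub>F \<epsilon>::real in at_right 0. \<epsilon> powr (1 / \<gamma> - 1 / (\<gamma> + 1)) < c / 2"
    using order_tendstoD(2) c by (metis half_gt_zero)
  have "((\<lambda>\<epsilon>. - 2 / B * W \<epsilon>) \<longlongrightarrow> 0) (at_right 0)"
    by (intro tendsto_mult_right_zero W_lim)
  moreover have "\<forall>\<^sub>F \<epsilon> in at_right 0. \<forall>\<xi> < - 2 / B * W \<epsilon>.
       1 * \<epsilon> powr (1 / \<gamma>) * exp (A * \<epsilon> powr (- 1 / \<gamma>) * \<xi>) \<le> V \<epsilon> \<xi> - (1 + \<epsilon> powr (1 / \<gamma>)) \<and>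
       V \<epsilon> \<xi> - (1 + \<epsilon> powr (1 / \<gamma>)) \<le> 1 * \<epsilon> powr (1 / \<gamma>) * exp (B / 2 * \<epsilon> powr (- 1 / \<gamma>) * \<xi>)"
    using volume_profiles_shock[OF mu gamma V] shock_speed_bounds[OF mu gamma vp] V0 W_small scales
  proof eventually_elim
    case (elim \<epsilon>)
    define \<delta> where "\<delta> = \<epsilon> powr (1 / \<gamma>)"
    from elim(1) obtain s where eps: "\<epsilon> > 0" and shock: "viscous_shock \<mu> \<gamma> \<epsilon> (1 + \<delta>) v\<^sub>p s"
      and range: "\<And>\<xi>. 1 + \<delta> < V \<epsilon> \<xi>" "\<And>\<xi>. V \<epsilon> \<xi> < v\<^sub>p"
      and ode: "\<And>\<xi>. (V \<epsilon> has_real_derivative viscous_shock.profile_field \<mu> \<gamma> \<epsilon> (1 + \<delta>) s (V \<epsilon> \<xi>)) (at \<xi>)"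
      unfolding \<delta>_def by auto
    interpret viscous_shock \<mu> \<gamma> \<epsilon> "1 + \<delta>" v\<^sub>p s by (rule shock)
    have s: "a \<le> s" "s \<le> b"
      using elim(2) shock unfolding \<delta>_def a_def b_def by blast+
    have \<delta>: "\<delta> > 0" "\<epsilon> = \<delta> powr \<gamma>"
      using eps gamma by (auto simp: \<delta>_def powr_powr)
    have inv: "\<epsilon> powr (- 1 / \<gamma>) = 1 / \<delta>"
      using powr_minus_divide[of \<epsilon> "1 / \<gamma>"] by (simp add: \<delta>_def)
    have "\<delta> = \<epsilon> powr (1 / \<gamma> - 1 / (\<gamma> + 1)) * \<epsilon> powr (1 / (\<gamma> + 1))"
      by (simp add: \<delta>_def powr_add[symmetric])
    also have "\<dots> \<le> c / 2 * \<epsilon> powr (1 / (\<gamma> + 1))"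
      using elim(5) by (intro mult_right_mono) auto
    finally have W_ge: "2 * \<delta> \<le> W \<epsilon>" by (simp add: W_def)
    have w0: "V \<epsilon> 0 - (1 + \<delta>) = W \<epsilon> - \<delta>"
      using elim(3) by (simp add: W_def)
    \<comment> \<open>Monotonicity puts the largest excess on the left half-line at the origin, so
      smallness of \<open>W \<epsilon>\<close> alone gives the lower field bound there.\<close>
    have "V \<epsilon> \<xi> \<le> V \<epsilon> 0" if "\<xi> \<le> 0" for \<xi>
    proof (rule DERIV_nonneg_imp_nondecreasing[OF that])
      fix x
      have "profile_field (V \<epsilon> x) \<ge> 0"
        using profile_field_pos[OF range(1)[of x] range(2)[of x]] by simp
      then show "\<exists>y. (V \<epsilon> has_real_derivative y) (at x) \<and> 0 \<le> y"
        using ode by blast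
    qed
    then have le_W: "V \<epsilon> \<xi> - (1 + \<delta>) \<le> W \<epsilon>" if "\<xi> \<le> 0" for \<xi>
      using that w0 \<delta>(1) by (smt (verit))
    have lower: "B * min 1 ((V \<epsilon> \<xi> - (1 + \<delta>)) / \<delta>) \<le> profile_field (V \<epsilon> \<xi>)" if "\<xi> \<le> 0" for \<xi>
      unfolding B_def
    proof (rule profile_field_lower[OF \<delta>(1) refl \<delta>(2) range s(2)])
      have "b\<^sup>2 * (V \<epsilon> \<xi> - (1 + \<delta>)) \<le> b\<^sup>2 * W \<epsilon>" "b\<^sup>2 * \<delta> \<le> b\<^sup>2 * W \<epsilon>"
        using le_W[OF that] W_ge \<delta>(1) by (auto intro!: mult_left_mono)
      then show "b\<^sup>2 * (V \<epsilon> \<xi> - (1 + \<delta>)) \<le> \<gamma> / (2 + \<gamma>) / 2" "b\<^sup>2 * \<delta> \<le> \<gamma> / (2 + \<gamma>) / 2"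
        using elim(4) unfolding k_def by linarith+
    qed
    have upper: "profile_field (V \<epsilon> \<xi>) \<le> A / \<delta> * (V \<epsilon> \<xi> - (1 + \<delta>))" for \<xi>
      unfolding A_def by (rule profile_field_upper[OF \<delta>(1) refl \<delta>(2) range pos(1) s(1)])
    have dw: "((\<lambda>\<xi>. V \<epsilon> \<xi> - (1 + \<delta>)) has_real_derivative profile_field (V \<epsilon> \<xi>)) (at \<xi>)" for \<xi>
      using ode[of \<xi>] by (auto intro!: derivative_eq_intros)
    have decay: "\<delta> * exp (A / \<delta> * \<xi>) \<le> V \<epsilon> \<xi> - (1 + \<delta>)" "V \<epsilon> \<xi> - (1 + \<delta>) \<le> \<delta> * exp (B / 2 / \<delta> * \<xi>)"
      if "\<xi> < - 2 / B * W \<epsilon>" for \<xi>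
    proof -
      \<comment> \<open>Replacing the excess by the larger \<open>W \<epsilon>\<close> moves the
        threshold further left and makes it an explicit null sequence.\<close>
      have "- 2 / B * W \<epsilon> \<le> - 2 * (V \<epsilon> 0 - (1 + \<delta>)) / B"
        unfolding w0 using \<delta>(1) pos(4) by (simp add: field_simps)
      then have \<xi>: "\<xi> < - 2 * (V \<epsilon> 0 - (1 + \<delta>)) / B"
        using that by (rule less_le_trans[rotated])
      have "V \<epsilon> 0 - (1 + \<delta>) \<ge> \<delta>" using w0 W_ge by linarith
      note backward_decay[OF \<delta>(1) pos(3,4) _ this dw upper lower \<xi>]
      then show "\<delta> * exp (A / \<delta> * \<xi>) \<le> V \<epsilon> \<xi> - (1 + \<delta>)" "V \<epsilon> \<xi> - (1 + \<delta>) \<le> \<delta> * exp (B / 2 / \<delta> * \<xi>)"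
        using range(1) by auto
    qed
    show ?case
      unfolding inv \<delta>_def[symmetric] using decay by simp
  qed
  ultimately show thesis
    \<comment> \<open>Both prefactors are 1; the slower rate \<open>B / 2\<close> belongs to the
      upper estimate, the rate \<open>A\<close> to the lower one.\<close>
    using that[of 1 1 "B / 2" A "\<lambda>\<epsilon>. - 2 / B * W \<epsilon>"] pos by simp
qed

section \<open>Existence and uniqueness of fronts\<close>

lemma front_exists_unique:
  assumes mu: "\<mu> > 0" and gamma: "\<gamma> > 0" and eps: "\<epsilon> > 0"
    and states: "front_states (pressure \<gamma> \<epsilon>) v\<^sub>m v\<^sub>p u\<^sub>m u\<^sub>p"
  shows "\<exists>s U V. travelling_front \<mu> (pressure \<gamma> \<epsilon>) v\<^sub>m v\<^sub>p u\<^sub>m u\<^sub>p s U V"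
    and "travelling_front \<mu> (pressure \<gamma> \<epsilon>) v\<^sub>m v\<^sub>p u\<^sub>m u\<^sub>p s U V \<Longrightarrow>
      travelling_front \<mu> (pressure \<gamma> \<epsilon>) v\<^sub>m v\<^sub>p u\<^sub>m u\<^sub>p s' U' V' \<Longrightarrow>
      s' = s \<and> (\<exists>C. \<forall>\<xi>. U' \<xi> = U (\<xi> + C) \<and> V' \<xi> = V (\<xi> + C))"
    and "travelling_front \<mu> (pressure \<gamma> \<epsilon>) v\<^sub>m v\<^sub>p u\<^sub>m u\<^sub>p s U V \<Longrightarrow>
      s\<^sup>2 = - (pressure \<gamma> \<epsilon> v\<^sub>p - pressure \<gamma> \<epsilon> v\<^sub>m) / (v\<^sub>p - v\<^sub>m)"
proof -
  note profile = travelling_front_profile[OF mu gamma eps states]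
  show "\<exists>s U V. travelling_front \<mu> (pressure \<gamma> \<epsilon>) v\<^sub>m v\<^sub>p u\<^sub>m u\<^sub>p s U V"
  proof -
    from states have vm: "1 < v\<^sub>m" and vmp: "v\<^sub>m < v\<^sub>p" and u: "u\<^sub>p < u\<^sub>m"
      and jump: "(u\<^sub>p - u\<^sub>m)\<^sup>2 = - (v\<^sub>p - v\<^sub>m) * (pressure \<gamma> \<epsilon> v\<^sub>p - pressure \<gamma> \<epsilon> v\<^sub>m)"
      by (auto simp: front_states_def)
    \<comment> \<open>The only speed compatible with mass conservation; it is positive because
      \<open>u\<^sub>p < u\<^sub>m\<close>.\<close>
    define s where "s = (u\<^sub>m - u\<^sub>p) / (v\<^sub>p - v\<^sub>m)"
    have speed: "s > 0" "s * (v\<^sub>p - v\<^sub>m) = u\<^sub>m - u\<^sub>p"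
      using u vmp by (auto simp: s_def)
    have "s\<^sup>2 * (v\<^sub>p - v\<^sub>m)\<^sup>2 = (u\<^sub>p - u\<^sub>m)\<^sup>2"
      by (metis speed(2) power_mult_distrib power2_commute)
    then have "(v\<^sub>p - v\<^sub>m) * (s\<^sup>2 * (v\<^sub>p - v\<^sub>m)) = (v\<^sub>p - v\<^sub>m) * (pressure \<gamma> \<epsilon> v\<^sub>m - pressure \<gamma> \<epsilon> v\<^sub>p)"
      unfolding jump by (simp add: power2_eq_square algebra_simps)
    then have "s\<^sup>2 * (v\<^sub>p - v\<^sub>m) = pressure \<gamma> \<epsilon> v\<^sub>m - pressure \<gamma> \<epsilon> v\<^sub>p"
      using vmp by simp
    then interpret viscous_shock \<mu> \<gamma> \<epsilon> v\<^sub>m v\<^sub>p s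
      using mu gamma eps vm vmp speed(1) by unfold_locales
    obtain V where V: "\<And>\<xi>. V \<xi> \<in> {v\<^sub>m<..<v\<^sub>p}"
      "\<And>\<xi>. (V has_real_derivative profile_field (V \<xi>)) (at \<xi>)" "(V \<longlongrightarrow> v\<^sub>m) at_bot" "(V \<longlongrightarrow> v\<^sub>p) at_top"
      using profile_exists by blast
    have "u\<^sub>p = u\<^sub>m - s * (v\<^sub>p - v\<^sub>m)" using speed(2) by simp
    then show ?thesis
      using profile_travelling_front[OF V] by blast
  qed
  show "s' = s \<and> (\<exists>C. \<forall>\<xi>. U' \<xi> = U (\<xi> + C) \<and> V' \<xi> = V (\<xi> + C))"
    if f: "travelling_front \<mu> (pressure \<gamma> \<epsilon>) v\<^sub>m v\<^sub>p u\<^sub>m u\<^sub>p s U V"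
    and f': "travelling_front \<mu> (pressure \<gamma> \<epsilon>) v\<^sub>m v\<^sub>p u\<^sub>m u\<^sub>p s' U' V'"
  proof -
    note p = profile[OF f] and p' = profile[OF f']
    have eq: "s' = s" using p(1) p'(1) by simp
    interpret viscous_shock \<mu> \<gamma> \<epsilon> v\<^sub>m v\<^sub>p s by (rule p(2))
    \<comment> \<open>Equal speeds mean that both volumes solve the same scalar equation. The shift
      found for them carries over to the velocities, which are the same affine function of the
      volume.\<close>
    obtain C where "\<And>\<xi>. V' \<xi> = V (\<xi> + C)"
      using profile_unique_up_to_shift[OF p(5,4) p'(5) p'(4)[unfolded eq]] by blast
    then show ?thesis
      using eq p(3) p'(3) by auto
  qed
  show "s\<^sup>2 = - (pressure \<gamma> \<epsilon> v\<^sub>p - pressure \<gamma> \<epsilon> v\<^sub>m) / (v\<^sub>p - v\<^sub>m)"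
    if f: "travelling_front \<mu> (pressure \<gamma> \<epsilon>) v\<^sub>m v\<^sub>p u\<^sub>m u\<^sub>p s U V"
  proof -
    interpret viscous_shock \<mu> \<gamma> \<epsilon> v\<^sub>m v\<^sub>p s by (rule profile(2)[OF f])
    show ?thesis
      using rankine_hugoniot vmp by (simp add: field_simps)
  qed
qed

theorem proposition1p1:
  fixes \<mu> \<gamma> :: real
  assumes "\<mu> > 0" and "\<gamma> > 0"
  shows
    "(\<forall>\<epsilon> v\<^sub>m v\<^sub>p u\<^sub>m u\<^sub>p. \<epsilon> > 0 \<and> front_states (pressure \<gamma> \<epsilon>) v\<^sub>m v\<^sub>p u\<^sub>m u\<^sub>p \<longrightarrow>
        (\<exists>s U V. travelling_front \<mu> (pressure \<gamma> \<epsilon>) v\<^sub>m v\<^sub>p u\<^sub>m u\<^sub>p s U V) \<and>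
        (\<forall>s U V s' U' V'.
           travelling_front \<mu> (pressure \<gamma> \<epsilon>) v\<^sub>m v\<^sub>p u\<^sub>m u\<^sub>p s U V \<and>
           travelling_front \<mu> (pressure \<gamma> \<epsilon>) v\<^sub>m v\<^sub>p u\<^sub>m u\<^sub>p s' U' V' \<longrightarrow>
           s' = s \<and> (\<exists>C. \<forall>\<xi>. U' \<xi> = U (\<xi> + C) \<and> V' \<xi> = V (\<xi> + C))) \<and>
        (\<forall>s U V. travelling_front \<mu> (pressure \<gamma> \<epsilon>) v\<^sub>m v\<^sub>p u\<^sub>m u\<^sub>p s U V \<longrightarrow>
           s\<^sup>2 = - (pressure \<gamma> \<epsilon> v\<^sub>p - pressure \<gamma> \<epsilon> v\<^sub>m) / (v\<^sub>p - v\<^sub>m)))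
     \<and>
     (\<forall>v\<^sub>p > 1.
        (\<forall>u\<^sub>m u\<^sub>p. (u\<^sub>m - u\<^sub>p) / (v\<^sub>p - 1) = 1 / sqrt (v\<^sub>p - 1) \<longrightarrow>
           (\<exists>ubar. congested_velocity \<mu> v\<^sub>p u\<^sub>m u\<^sub>p ubar) \<and>
           (\<forall>ubar. congested_velocity \<mu> v\<^sub>p u\<^sub>m u\<^sub>p ubar \<longrightarrow>
              (let sbar = (u\<^sub>m - u\<^sub>p) / (v\<^sub>p - 1)
               in limit_solution \<mu> (travelling_wave sbar ubar)
                    (travelling_wave sbar (vbar \<mu> v\<^sub>p))
                    (travelling_wave sbar (pbar v\<^sub>p u\<^sub>m u\<^sub>p))))) \<and>
        (\<forall>V. volume_profiles \<mu> \<gamma> v\<^sub>p V \<longrightarrow>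
           ((\<lambda>\<epsilon>. SUP \<xi>. INF C. ereal \<bar>V \<epsilon> (\<xi> + C) - vbar \<mu> v\<^sub>p \<xi>\<bar>) \<longlongrightarrow> 0) (at_right 0)))
     \<and>
     (\<forall>v\<^sub>p > 1. \<gamma> \<ge> 1 \<longrightarrow>
        (\<forall>V c. volume_profiles \<mu> \<gamma> v\<^sub>p V \<and> c > 0 \<and>
           (\<forall>\<^sub>F \<epsilon> in at_right 0. V \<epsilon> 0 - 1 = c * \<epsilon> powr (1 / (\<gamma> + 1))) \<longrightarrow>
           (\<exists>Cup Clow \<sigma>up \<sigma>low \<xi>\<^sub>0.
              Cup > 0 \<and> Clow > 0 \<and> \<sigma>up > 0 \<and> \<sigma>low > 0 \<and>
              (\<xi>\<^sub>0 \<longlongrightarrow> 0) (at_right 0) \<and>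
              (\<forall>\<^sub>F \<epsilon> in at_right 0. \<forall>\<xi> < \<xi>\<^sub>0 \<epsilon>.
                 Clow * \<epsilon> powr (1 / \<gamma>) * exp (\<sigma>low * \<epsilon> powr (- 1 / \<gamma>) * \<xi>)
                   \<le> V \<epsilon> \<xi> - (1 + \<epsilon> powr (1 / \<gamma>)) \<and>
                 V \<epsilon> \<xi> - (1 + \<epsilon> powr (1 / \<gamma>))
                   \<le> Cup * \<epsilon> powr (1 / \<gamma>) * exp (\<sigma>up * \<epsilon> powr (- 1 / \<gamma>) * \<xi>)))))"
proof (intro conjI allI impI)
  fix \<epsilon> v\<^sub>m v\<^sub>p u\<^sub>m u\<^sub>p :: real
  assume "\<epsilon> > 0 \<and> front_states (pressure \<gamma> \<epsilon>) v\<^sub>m v\<^sub>p u\<^sub>m u\<^sub>p"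
  then have eps: "\<epsilon> > 0" and states: "front_states (pressure \<gamma> \<epsilon>) v\<^sub>m v\<^sub>p u\<^sub>m u\<^sub>p" by auto
  note front = front_exists_unique[OF assms eps states]
  show "\<exists>s U V. travelling_front \<mu> (pressure \<gamma> \<epsilon>) v\<^sub>m v\<^sub>p u\<^sub>m u\<^sub>p s U V"
    by (rule front(1))
  show "s' = s" "\<exists>C. \<forall>\<xi>. U' \<xi> = U (\<xi> + C) \<and> V' \<xi> = V (\<xi> + C)"
    if "travelling_front \<mu> (pressure \<gamma> \<epsilon>) v\<^sub>m v\<^sub>p u\<^sub>m u\<^sub>p s U V \<and>
      travelling_front \<mu> (pressure \<gamma> \<epsilon>) v\<^sub>m v\<^sub>p u\<^sub>m u\<^sub>p s' U' V'" for s U V s' U' V'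
    using front(2) that by blast+
  show "s\<^sup>2 = - (pressure \<gamma> \<epsilon> v\<^sub>p - pressure \<gamma> \<epsilon> v\<^sub>m) / (v\<^sub>p - v\<^sub>m)"
    if "travelling_front \<mu> (pressure \<gamma> \<epsilon>) v\<^sub>m v\<^sub>p u\<^sub>m u\<^sub>p s U V" for s U V
    using that by (rule front(3))
next
  fix v\<^sub>p u\<^sub>m u\<^sub>p :: real
  assume vp: "v\<^sub>p > 1" and speed: "(u\<^sub>m - u\<^sub>p) / (v\<^sub>p - 1) = 1 / sqrt (v\<^sub>p - 1)"
  show "\<exists>ubar. congested_velocity \<mu> v\<^sub>p u\<^sub>m u\<^sub>p ubar"
    using congested_velocity_exists[OF assms(1) vp refl] by blast
  \<comment> \<open>Uniqueness of the congested velocity reduces an arbitrary \<open>ubar\<close> to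
    the explicit profile.\<close>
  show "let sbar = (u\<^sub>m - u\<^sub>p) / (v\<^sub>p - 1)
      in limit_solution \<mu> (travelling_wave sbar ubar) (travelling_wave sbar (vbar \<mu> v\<^sub>p))
        (travelling_wave sbar (pbar v\<^sub>p u\<^sub>m u\<^sub>p))"
    if "congested_velocity \<mu> v\<^sub>p u\<^sub>m u\<^sub>p ubar" for ubar
    unfolding Let_def congested_velocity_unique[OF assms(1) vp refl that]
    by (rule congested_wave_limit_solution[OF assms(1) vp speed refl])
next
  fix v\<^sub>p :: real and V
  assume "v\<^sub>p > 1" "volume_profiles \<mu> \<gamma> v\<^sub>p V"
  then show "((\<lambda>\<epsilon>. SUP \<xi>. INF C. ereal \<bar>V \<epsilon> (\<xi> + C) - vbar \<mu> v\<^sub>p \<xi>\<bar>) \<longlongrightarrow> 0) (at_right 0)"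
    by (rule volume_profiles_converge[OF assms])
next
  fix v\<^sub>p c :: real and V
  assume vp: "v\<^sub>p > 1" and V: "volume_profiles \<mu> \<gamma> v\<^sub>p V \<and> c > 0 \<and>
    (\<forall>\<^sub>F \<epsilon> in at_right 0. V \<epsilon> 0 - 1 = c * \<epsilon> powr (1 / (\<gamma> + 1)))"
  from V have V': "volume_profiles \<mu> \<gamma> v\<^sub>p V" "c > 0"
    "\<forall>\<^sub>F \<epsilon> in at_right 0. V \<epsilon> 0 - 1 = c * \<epsilon> powr (1 / (\<gamma> + 1))" by auto
  show "\<exists>Cup Clow \<sigma>up \<sigma>low \<xi>\<^sub>0.
      Cup > 0 \<and> Clow > 0 \<and> \<sigma>up > 0 \<and> \<sigma>low > 0 \<and> (\<xi>\<^sub>0 \<longlongrightarrow> 0) (at_right 0) \<and>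
      (\<forall>\<^sub>F \<epsilon> in at_right 0. \<forall>\<xi> < \<xi>\<^sub>0 \<epsilon>.
         Clow * \<epsilon> powr (1 / \<gamma>) * exp (\<sigma>low * \<epsilon> powr (- 1 / \<gamma>) * \<xi>)
           \<le> V \<epsilon> \<xi> - (1 + \<epsilon> powr (1 / \<gamma>)) \<and>
         V \<epsilon> \<xi> - (1 + \<epsilon> powr (1 / \<gamma>))
           \<le> Cup * \<epsilon> powr (1 / \<gamma>) * exp (\<sigma>up * \<epsilon> powr (- 1 / \<gamma>) * \<xi>))"
    by (rule volume_profiles_decay[OF assms vp V']) blast
qed

end
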